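(* Let $d\in\mathbb{N}$, let $W\subset\mathbb{R}^d$ be a non-empty bounded open set and let $\Phi_1,\Phi_2,\ldots$ be independent and identically distributed point processes on $\mathbb{R}^d$ observed in $W$, with well-defined intensity function $\lambda$ and pair correlation function $g$. Suppose that $g:W\times W\to\mathbb{R}$ is bounded and that $\lambda:W\to(\underline\lambda,\bar\lambda)$, with $0<\underline\lambda<\bar\lambda<\infty$, is bounded, bounded away from zero and five times continuously differentiable on $W$ with bounded partial derivatives. Let $\gamma>5$ and let $(h_n)_{n\in\mathbb{N}}$ be a sequence of positive bandwidths with $h_n\to0$ and $nh_n^d\to\infty$ as $n\to\infty$. For $x_0\in W$ consider the adaptive estimator \[ \tilde\lambda(x_0)=\frac1n\sum_{i=1}^n\sum_{y\in\Phi_i\cap W}\frac{c(y)^d}{h_n^d}\,\kappa^\gamma\Big(\frac{x_0-y}{h_n}\,c(y)\Big),\qquad c(x)=\sqrt{\frac{\lambda(x)}{\lambda(x_0)}},\quad x\in W, \] where $\kappa^\gamma$ is the Beta kernel. Then, for $x_0\in W$, as $n\to\infty$, 1. $\displaystyle\mathrm{bias}\,\tilde\lambda(x_0)=\lambda(x_0)\,h_n^4\int_{\mathbb{R}^d}A(u;x_0)\,du+o(h_n^4)$, where \begin{align*} A(u;x_0)={}&\frac{Dg_u(1)}{24}D^4c(x_0)(u,u,u,u)+\frac{D^4g_u(1)}{24}\big(Dc(x_0)u\big)^4\\ &+\frac{D^2g_u(1)}{2}\Big\{\frac13\,Dc(x_0)u\;D^3c(x_0)(u,u,u)+\frac14\big(D^2c(x_0)(u,u)\big)^2\Big\}\\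 &+\frac{D^3g_u(1)}{4}\big(Dc(x_0)u\big)^2D^2c(x_0)(u,u) \end{align*} and $g_u(v)=v^{d+2}\kappa^\gamma(vu)$ for $v\in\mathbb{R}$, $u\in\mathbb{R}^d$; 2. $\displaystyle\mathrm{Var}\,\tilde\lambda(x_0)=\frac{\lambda(x_0)Q(d,\gamma)}{nh_n^d}+O\Big(\frac{1}{nh_n^{d-1}}\Big)$.
   Context: Point processes: the factorial moment measures of $\Phi_1$ of first and second order exist (as locally finite measures) and, on $W$ and $W\times W$ respectively, are absolutely continuous with respect to Lebesgue measure with densities $\lambda$ (the intensity function) and $\rho^{(2)}$ (the second order product density). That is, $\mathbb{E}\sum_{y\in\Phi_1\cap W}f(y)=\int_W f\lambda\,du$ and $\mathbb{E}\sum_{y\ne z\in\Phi_1\cap W}f(y,z)=\int_{W^2}f\rho^{(2)}\,du\,dv$ for non-negative measurable $f$. The pair correlation function is $g(u,v)=\rho^{(2)}(u,v)/(\lambda(u)\lambda(v))$ for $u,v\in W$ (not to be confused with the functions $g_u$). Beta kernel: for $\gamma\ge0$, $\kappa^\gamma(x)=c(d,\gamma)^{-1}(1-x^Tx)^\gamma\,1\{x\in b(0,1)\}$, $x\in\mathbb{R}^d$, where $b(0,1)$ is the closed unit ball of $\mathbb{R}^d$ centred at the origin and $c(d,\gamma)=\int_{b(0,1)}(1-x^Tx)^\gamma dx=\pi^{d/2}\Gamma(\gamma+1)/\Gamma(d/2+\gamma+1)$ (a normalising constant, not to be confused with the weight function $c(\cdot)$). Constant: $Q(d,\gamma)=\int_{\mathbb{R}^d}\kappa^\gamma(x)^2dx=c(d,2\gamma)/c(d,\gamma)^2$.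 Derivatives: for a function $f$ on an open subset of $\mathbb{R}^d$, $D^rf(x)(u,\dots,u)=\sum_{j_1,\dots,j_r=1}^d u_{j_1}\cdots u_{j_r}D_{j_1\cdots j_r}f(x)$, with $D_{j_1\cdots j_r}$ the partial derivatives, and $Df(x)u=\sum_j u_jD_jf(x)$. $D^kg_u(1)$ is the $k$-th derivative of the one-variable function $v\mapsto g_u(v)$ at $v=1$. The bias is $\mathrm{bias}\,\tilde\lambda(x_0)=\mathbb{E}\,\tilde\lambda(x_0)-\lambda(x_0)$. *)

theory Defs
  imports "HOL-Probability.Probability" "HOL-Library.Landau_Symbols"
begin

section \<open>Point processes on Euclidean space\<close>

definition locally_finite_configs :: "(real ^ 'd) set set" where
  "locally_finite_configs = {\<phi>. \<forall>B. bounded B \<longrightarrow> finite (\<phi> \<inter> B)}"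

text \<open>The sigma-algebra on configurations generated by the counts \<open>card (\<phi> \<inter> B)\<close>
  for bounded Borel \<open>B\<close>; only its measurable space is used.\<close>

definition config_space :: "(real ^ 'd) set measure" where
  "config_space = sigma locally_finite_configs
     {{\<phi> \<in> locally_finite_configs. card (\<phi> \<inter> B) = k} | B k. B \<in> sets borel \<and> bounded B}"

definition point_process :: "'w measure \<Rightarrow> ('w \<Rightarrow> (real ^ 'd) set) \<Rightarrow> bool" where
  "point_process M X \<longleftrightarrow> prob_space M \<and> X \<in> measurable M config_space"

text \<open>A family indexed by \<open>1, 2, \<dots>\<close>; the value at index \<open>0\<close> is irrelevant.\<close>

definition iid_point_processes :: "'w measure \<Rightarrow> (nat \<Rightarrow> 'w \<Rightarrow> (real ^ 'd) set) \<Rightarrow> bool" where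
  "iid_point_processes M \<Phi> \<longleftrightarrow>
     (\<forall>i\<ge>1. point_process M (\<Phi> i)) \<and>
     prob_space.indep_vars M (\<lambda>_. config_space) \<Phi> {1..} \<and>
     (\<forall>i\<ge>1. distr M config_space (\<Phi> i) = distr M config_space (\<Phi> 1))"

definition factorial_moment1 ::
  "'w measure \<Rightarrow> ('w \<Rightarrow> (real ^ 'd) set) \<Rightarrow> (real ^ 'd) set \<Rightarrow> ennreal" where
  "factorial_moment1 M X B = (\<integral>\<^sup>+\<omega>. emeasure (count_space UNIV) (X \<omega> \<inter> B) \<partial>M)"

definition distinct_pairs :: "'a set \<Rightarrow> ('a \<times> 'a) set" where
  "distinct_pairs A = {(y, z). y \<in> A \<and> z \<in> A \<and> y \<noteq> z}"

definition factorial_moment2 ::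
  "'w measure \<Rightarrow> ('w \<Rightarrow> (real ^ 'd) set) \<Rightarrow> ((real ^ 'd) \<times> (real ^ 'd)) set \<Rightarrow> ennreal" where
  "factorial_moment2 M X C =
     (\<integral>\<^sup>+\<omega>. emeasure (count_space UNIV) (distinct_pairs (X \<omega>) \<inter> C) \<partial>M)"

definition locally_finite_factorial_moments ::
  "'w measure \<Rightarrow> ('w \<Rightarrow> (real ^ 'd) set) \<Rightarrow> bool" where
  "locally_finite_factorial_moments M X \<longleftrightarrow>
     (\<forall>B\<in>sets borel. bounded B \<longrightarrow> factorial_moment1 M X B < \<infinity>) \<and>
     (\<forall>C\<in>sets borel. bounded C \<longrightarrow> factorial_moment2 M X C < \<infinity>)"

text \<open>In the next two definitions the window \<open>W\<close> is meant to be bounded, so that the sums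
  over the points of a locally finite configuration in \<open>W\<close> are finite.\<close>

definition intensity_function ::
  "'w measure \<Rightarrow> ('w \<Rightarrow> (real ^ 'd) set) \<Rightarrow> (real ^ 'd) set \<Rightarrow> (real ^ 'd \<Rightarrow> real) \<Rightarrow> bool" where
  "intensity_function M X W l \<longleftrightarrow>
     l \<in> borel_measurable (restrict_space borel W) \<and> (\<forall>u\<in>W. 0 \<le> l u) \<and>
     (\<forall>f :: real ^ 'd \<Rightarrow> ennreal. f \<in> borel_measurable borel \<longrightarrow>
        (\<integral>\<^sup>+\<omega>. (\<Sum>y\<in>X \<omega> \<inter> W. f y) \<partial>M) = (\<integral>\<^sup>+u\<in>W. (f u * ennreal (l u)) \<partial>lborel))"

definition second_order_product_density ::
  "'w measure \<Rightarrow> ('w \<Rightarrow> (real ^ 'd) set) \<Rightarrow> (real ^ 'd) set \<Rightarrow>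
     (real ^ 'd \<Rightarrow> real ^ 'd \<Rightarrow> real) \<Rightarrow> bool" where
  "second_order_product_density M X W r \<longleftrightarrow>
     (\<lambda>(u, v). r u v) \<in> borel_measurable (restrict_space borel (W \<times> W)) \<and>
     (\<forall>u\<in>W. \<forall>v\<in>W. 0 \<le> r u v) \<and>
     (\<forall>f :: (real ^ 'd) \<times> (real ^ 'd) \<Rightarrow> ennreal. f \<in> borel_measurable borel \<longrightarrow>
        (\<integral>\<^sup>+\<omega>. (\<Sum>p\<in>distinct_pairs (X \<omega> \<inter> W). f p) \<partial>M) =
        (\<integral>\<^sup>+p\<in>W \<times> W. (f p * ennreal (r (fst p) (snd p))) \<partial>lborel))"

definition pair_correlation ::
  "('a \<Rightarrow> real) \<Rightarrow> ('a \<Rightarrow> 'a \<Rightarrow> real) \<Rightarrow> 'a \<Rightarrow> 'a \<Rightarrow> real" where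
  "pair_correlation l r u v = r u v / (l u * l v)"

section \<open>Partial derivatives\<close>

definition partial_derivative :: "'d::finite \<Rightarrow> (real ^ 'd \<Rightarrow> real) \<Rightarrow> real ^ 'd \<Rightarrow> real" where
  "partial_derivative j f x = deriv (\<lambda>t. f (x + t *\<^sub>R axis j 1)) 0"

text \<open>\<open>partial_derivatives [j1, \<dots>, jr] f\<close> is the iterated partial derivative
  in the directions \<open>j1, \<dots>, jr\<close>.\<close>

definition partial_derivatives :: "'d list \<Rightarrow> (real ^ 'd \<Rightarrow> real) \<Rightarrow> real ^ 'd \<Rightarrow> real" where
  "partial_derivatives js f = foldr partial_derivative js f"

text \<open>All partial derivatives up to order \<open>k\<close> exist and are continuous on the
  open set \<open>W\<close>. Differentiability is required explicitly because \<^const>\<open>deriv\<close> is total.\<close>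

definition times_continuously_differentiable_on ::
  "nat \<Rightarrow> (real ^ 'd \<Rightarrow> real) \<Rightarrow> (real ^ 'd) set \<Rightarrow> bool" where
  "times_continuously_differentiable_on k f W \<longleftrightarrow>
     (\<forall>js. length js < k \<longrightarrow> (\<forall>j. \<forall>x\<in>W.
        (\<lambda>t. partial_derivatives js f (x + t *\<^sub>R axis j 1)) differentiable (at 0))) \<and>
     (\<forall>js. length js \<le> k \<longrightarrow> continuous_on W (partial_derivatives js f))"

definition bounded_partial_derivatives_on ::
  "nat \<Rightarrow> (real ^ 'd \<Rightarrow> real) \<Rightarrow> (real ^ 'd) set \<Rightarrow> bool" where
  "bounded_partial_derivatives_on k f W \<longleftrightarrow>
     (\<forall>js. 1 \<le> length js \<and> length js \<le> k \<longrightarrow> bounded (partial_derivatives js f ` W))"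

text \<open>\<open>diagonal_derivative r f x u\<close> is \<open>D^r f(x)(u, \<dots>, u)\<close>.\<close>

definition diagonal_derivative ::
  "nat \<Rightarrow> (real ^ 'd \<Rightarrow> real) \<Rightarrow> real ^ 'd \<Rightarrow> real ^ 'd \<Rightarrow> real" where
  "diagonal_derivative r f x u =
     (\<Sum>js\<in>{js :: 'd list. length js = r}.
        prod_list (map (\<lambda>j. u $ j) js) * partial_derivatives js f x)"

section \<open>Beta kernel and adaptive estimator\<close>

text \<open>For \<open>\<gamma> = 0\<close>, \<open>0 powr 0 = 0\<close> makes the kernel below vanish on the unit sphere (a null
  set); for \<open>\<gamma> > 0\<close> it is exactly the Beta kernel.\<close>

definition beta_normaliser :: "'d::finite itself \<Rightarrow> real \<Rightarrow> real" where
  "beta_normaliser _ \<gamma> = (LINT x:cball (0 :: real ^ 'd) 1|lborel. (1 - x \<bullet> x) powr \<gamma>)"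

definition beta_kernel :: "real \<Rightarrow> real ^ 'd \<Rightarrow> real" where
  "beta_kernel \<gamma> x =
     (1 - x \<bullet> x) powr \<gamma> / beta_normaliser TYPE('d) \<gamma> * indicator (cball 0 1) x"

definition beta_kernel_square_integral :: "'d::finite itself \<Rightarrow> real \<Rightarrow> real" where
  "beta_kernel_square_integral _ \<gamma> = (LINT x|lborel. (beta_kernel \<gamma> (x :: real ^ 'd))\<^sup>2)"

definition abramson_weight ::
  "(real ^ 'd \<Rightarrow> real) \<Rightarrow> real ^ 'd \<Rightarrow> real ^ 'd \<Rightarrow> real" where
  "abramson_weight l x0 x = sqrt (l x / l x0)"

definition adaptive_estimator ::
  "(nat \<Rightarrow> 'w \<Rightarrow> (real ^ 'd) set) \<Rightarrow> (real ^ 'd) set \<Rightarrow> (real ^ 'd \<Rightarrow> real) \<Rightarrow>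
     real \<Rightarrow> real \<Rightarrow> nat \<Rightarrow> real ^ 'd \<Rightarrow> 'w \<Rightarrow> real" where
  "adaptive_estimator \<Phi> W l \<gamma> h n x0 \<omega> =
     1 / real n * (\<Sum>i = 1..n. \<Sum>y\<in>\<Phi> i \<omega> \<inter> W.
       abramson_weight l x0 y ^ CARD('d) / h ^ CARD('d) *
       beta_kernel \<gamma> (abramson_weight l x0 y *\<^sub>R ((x0 - y) /\<^sub>R h)))"

definition bias :: "'w measure \<Rightarrow> ('w \<Rightarrow> real) \<Rightarrow> real \<Rightarrow> real" where
  "bias M X \<theta> = prob_space.expectation M X - \<theta>"

definition g_fun :: "real \<Rightarrow> real ^ 'd \<Rightarrow> real \<Rightarrow> real" where
  "g_fun \<gamma> u v = v ^ (CARD('d) + 2) * beta_kernel \<gamma> (v *\<^sub>R u)"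

definition bias_integrand ::
  "(real ^ 'd \<Rightarrow> real) \<Rightarrow> real \<Rightarrow> real ^ 'd \<Rightarrow> real ^ 'd \<Rightarrow> real" where
  "bias_integrand l \<gamma> x0 u =
    (let Dg = (\<lambda>k. (deriv ^^ k) (g_fun \<gamma> u) 1);
         Dc = (\<lambda>r. diagonal_derivative r (abramson_weight l x0) x0 u)
     in Dg 1 / 24 * Dc 4
        + Dg 4 / 24 * (Dc 1) ^ 4
        + Dg 2 / 2 * (1 / 3 * Dc 1 * Dc 3 + 1 / 4 * (Dc 2)\<^sup>2)
        + Dg 3 / 4 * (Dc 1)\<^sup>2 * Dc 2)"

end

theory Submission
  imports Defs
begin

text \<open>
  Write \<open>c\<close> for the Abramson weight, so that \<open>\<lambda> = \<lambda>(x\<^sub>0) c\<^sup>2\<close> on the window. By Campbell's formula the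
  mean of the estimator is the integral of its kernel against \<open>\<lambda>\<close>; the substitution
  \<open>y = x\<^sub>0 - h u\<close> absorbs the factor \<open>c\<^sup>2\<close> into the power of \<open>c\<close> in front of the kernel and gives
  \<open>\<lambda>(x\<^sub>0) \<integral> g\<^sub>u(c(x\<^sub>0 - h u)) du\<close>. The kernel vanishes unless \<open>c(x\<^sub>0 - h u) |u| \<le> 1\<close>, hence only a
  fixed ball of \<open>u\<close> matters, and for small \<open>h\<close> the integral over the window becomes one over this
  ball (\<open>window_integral\<close>).

  On that ball \<open>g\<^sub>u\<close> is expanded at \<open>1\<close> and \<open>h \<mapsto> c(x\<^sub>0 - h u)\<close> at \<open>0\<close>, both to order four with
  remainders that are uniform in \<open>u\<close>; composing the two expansions
  (\<open>taylor_compose_order_4\<close>) yields coefficients of \<open>h\<close>, ..., \<open>h\<^sup>4\<close> that are explicit in the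
  derivatives of \<open>g\<^sub>u\<close> and \<open>c\<close>. The odd coefficients are odd functions of \<open>u\<close> and integrate to
  zero. The coefficient of \<open>h\<^sup>2\<close> is a combination of \<open>D g\<^sub>u(1) p(u)\<close> and \<open>D\<^sup>2 g\<^sub>u(1) p(u)\<close> with \<open>p\<close>
  homogeneous of degree two. This is where the exponent \<open>d + 2\<close> in \<open>g\<^sub>u\<close> pays off: rescaling \<open>u\<close>
  shows that \<open>\<integral> g\<^sub>u(v) p(u) du\<close> does not depend on \<open>v\<close>, so the integrals of all its
  \<open>v\<close>-derivatives vanish (\<open>integral_bump_deriv_homogeneous\<close>). What survives is the term of
  order \<open>h\<^sup>4\<close>.

  For the variance, independence reduces the average to a single process. The second moment of a
  sum over one process splits into a sum over points and a sum over pairs of distinct points. The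
  latter is at most a constant times the square of the mean, because the pair correlation function is
  bounded; as the mean stays bounded, so does this part. The mean of the sum over points is
  again an integral of the kind above, now with the squared kernel, and its expansion to first
  order gives \<open>\<lambda>(x\<^sub>0) Q(d,\<gamma>) / h\<^sup>d + O(h\<^sup>1\<^sup>-\<^sup>d)\<close>, where the error absorbs bounded quantities. Averaging
  divides everything by \<open>n\<close>.
\<close>

section \<open>Derivatives of the Beta kernel along rays\<close>

text \<open>The case \<open>s = 0\<close> is the reason for \<open>a > 1\<close>: there the difference quotient is
  \<open>s\<^sub>+\<^sup>a\<^sup>-\<^sup>1\<close> and has to tend to \<open>0\<close>. This is where a large exponent buys smoothness of the kernel across
  the boundary of its support.\<close>

lemma DERIV_positive_part_powr:
  fixes a s :: real
  assumes "a > 1"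
  shows "((\<lambda>s. max 0 s powr a) has_real_derivative a * max 0 s powr (a - 1)) (at s)"
proof -
  consider "s > 0" | "s < 0" | "s = 0" by linarith
  then show ?thesis
  proof cases
    case 1
    have "((\<lambda>s. s powr a) has_real_derivative a * s powr (a - 1)) (at s)"
      using 1 by (rule has_real_derivative_powr)
    then have "((\<lambda>s. max 0 s powr a) has_real_derivative a * s powr (a - 1)) (at s)"
      by (rule has_field_derivative_transform_within_open[where S="{0<..}"]) (use 1 in auto)
    then show ?thesis using 1 by simp
  next
    case 2
    have "((\<lambda>s. 0::real) has_real_derivative 0) (at s)" by simp
    then have "((\<lambda>s. max 0 s powr a) has_real_derivative 0) (at s)"
      by (rule has_field_derivative_transform_within_open[where S="{..<0}"]) (use 2 in auto)
    then show ?thesis using 2 by simp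
  next
    case 3
    have "((\<lambda>s::real. max 0 s powr (a - 1)) \<longlongrightarrow> max 0 0 powr (a - 1)) (at 0)"
      using assms by (intro tendsto_powr' tendsto_intros) auto
    then have "((\<lambda>s::real. max 0 s powr (a - 1)) \<longlongrightarrow> 0) (at 0)"
      by simp
    then have "((\<lambda>t. (max 0 (0 + t) powr a - max 0 0 powr a) / t) \<longlongrightarrow> 0) (at (0::real))"
    proof (rule Lim_transform_eventually)
      show "\<forall>\<^sub>F x::real in at 0. max 0 x powr (a - 1)
          = (max 0 (0 + x) powr a - max 0 0 powr a) / x"
        by (auto simp: eventually_at powr_diff max_def intro!: exI[of _ 1])
    qed
    then show ?thesis using 3 by (simp add: DERIV_def)
  qed
qed

text \<open>For \<open>k + j < a\<close> this is the \<open>k\<close>-th derivative in \<open>v\<close> of \<open>v\<^sup>m |u|\<^sup>2\<^sup>j (1 - v\<^sup>2 |u|\<^sup>2)\<^sub>+\<^sup>a\<^sup>-\<^sup>j\<close>. Differentiating such a function gives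
  two functions of the same family, which is what the recursion records; with \<open>j = 0\<close> and
  \<open>m = d + 2\<close> it describes the derivatives of \<open>g\<^sub>u\<close> up to the normalising constant.\<close>

fun bump :: "real \<Rightarrow> nat \<Rightarrow> nat \<Rightarrow> nat \<Rightarrow> 'a::euclidean_space \<Rightarrow> real \<Rightarrow> real" where
  "bump a 0 m j u v = v ^ m * (u \<bullet> u) ^ j * max 0 (1 - v\<^sup>2 * (u \<bullet> u)) powr (a - real j)"
| "bump a (Suc k) m j u v =
     real m * bump a k (m - 1) j u v - 2 * (a - real j) * bump a k (m + 1) (j + 1) u v"

lemma DERIV_bump:
  assumes "a > real (k + j) + 1"
  shows "(bump a k m j u has_real_derivative bump a (Suc k) m j u v) (at v)"
  using assms
proof (induction k arbitrary: m j)
  case 0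
  let ?p = "\<lambda>v. max 0 (1 - v\<^sup>2 * (u \<bullet> u)) powr (a - real j)"
  have "((\<lambda>v. 1 - v\<^sup>2 * (u \<bullet> u)) has_real_derivative - 2 * v * (u \<bullet> u)) (at v)"
    by (auto intro!: derivative_eq_intros)
  from DERIV_chain2[OF DERIV_positive_part_powr this, of "a - real j"] 0
  have "(?p has_real_derivative (a - real j) * max 0 (1 - v\<^sup>2 * (u \<bullet> u)) powr (a - real j - 1)
          * (- 2 * v * (u \<bullet> u))) (at v)" by simp
  moreover have "((\<lambda>v. v ^ m * (u \<bullet> u) ^ j) has_real_derivative
      real m * v ^ (m - 1) * (u \<bullet> u) ^ j) (at v)"
    by (auto intro!: derivative_eq_intros)
  ultimately have "((\<lambda>v. v ^ m * (u \<bullet> u) ^ j * ?p v) has_real_derivative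
     real m * v ^ (m - 1) * (u \<bullet> u) ^ j * ?p v +
      (a - real j) * max 0 (1 - v\<^sup>2 * (u \<bullet> u)) powr (a - real j - 1) * (- 2 * v * (u \<bullet> u))
        * (v ^ m * (u \<bullet> u) ^ j)) (at v)"
    by (rule DERIV_mult[rotated])
  then show ?case
    by (simp add: algebra_simps)
next
  case (Suc k)
  have "(bump a k (m - 1) j u has_real_derivative bump a (Suc k) (m - 1) j u v) (at v)"
    "(bump a k (m + 1) (j + 1) u has_real_derivative bump a (Suc k) (m + 1) (j + 1) u v) (at v)"
    using Suc.prems by (auto intro!: Suc.IH simp del: bump.simps)
  then have "((\<lambda>v. real m * bump a k (m - 1) j u v - 2 * (a - real j) * bump a k (m + 1) (j + 1) u v)
     has_real_derivative (real m * bump a (Suc k) (m - 1) j u v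
       - 2 * (a - real j) * bump a (Suc k) (m + 1) (j + 1) u v)) (at v)"
    by (intro DERIV_diff DERIV_cmult)
  then show ?case by (simp only: bump.simps(2)[abs_def, symmetric] bump.simps(2)[symmetric])
qed

lemma bump_eq_0: "v\<^sup>2 * (u \<bullet> u) \<ge> 1 \<Longrightarrow> bump a k m j u v = 0"
  by (induction k arbitrary: m j) auto

lemma bump_minus: "bump a k m j (- u) v = bump a k m j u v"
  by (induction k arbitrary: m j) auto

lemma continuous_on_bump:
  assumes "a > real (k + j)"
  shows "continuous_on UNIV (\<lambda>(u :: 'a::euclidean_space, v). bump a k m j u v)"
  using assms
proof (induction k arbitrary: m j)
  case 0
  then show ?case
    by (auto simp: case_prod_unfold intro!: continuous_intros continuous_on_powr')
next
  case (Suc k)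
  have "continuous_on UNIV (\<lambda>(u :: 'a, v). bump a k (m - 1) j u v)"
    "continuous_on UNIV (\<lambda>(u :: 'a, v). bump a k (m + 1) (j + 1) u v)"
    using Suc.prems by (auto intro!: Suc.IH)
  then show ?case
    by (auto simp: case_prod_unfold intro!: continuous_intros)
qed

text \<open>Joint continuity in \<open>u\<close> and \<open>v\<close> and compactness. This makes the Taylor remainders below
  uniform in \<open>u\<close>.\<close>

lemma bounded_bump:
  fixes R V :: real
  assumes "a > real (k + j)"
  shows "\<exists>B. \<forall>u :: 'a::euclidean_space. \<forall>v. norm u \<le> R \<longrightarrow> \<bar>v\<bar> \<le> V \<longrightarrow> \<bar>bump a k m j u v\<bar> \<le> B"
proof -
  have "compact ((\<lambda>(u :: 'a, v). bump a k m j u v) ` (cball 0 R \<times> cball 0 V))"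
    by (intro compact_continuous_image compact_Times compact_cball
        continuous_on_subset[OF continuous_on_bump[OF assms]]) auto
  then obtain B where "\<forall>x \<in> (\<lambda>(u :: 'a, v). bump a k m j u v) ` (cball 0 R \<times> cball 0 V). norm x \<le> B"
    using compact_imp_bounded bounded_iff by metis
  then show ?thesis by (intro exI[of _ B]) force
qed

lemma taylor_remainder_bound:
  fixes c x B :: real
  assumes "\<bar>c\<bar> \<le> B"
  shows "\<bar>c / fact n * x ^ n\<bar> \<le> max 0 B * \<bar>x\<bar> ^ n"
proof -
  have "\<bar>c\<bar> / fact n \<le> max 0 B / 1"
    using assms by (intro frac_le) auto
  then show ?thesis
    unfolding abs_mult power_abs abs_divide by (intro mult_right_mono) auto
qed

lemma bump_taylor:
  fixes R V :: real
  assumes "a > real n"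
  shows "\<exists>B\<ge>0. \<forall>u :: 'a::euclidean_space. \<forall>v. norm u \<le> R \<longrightarrow> \<bar>v - 1\<bar> \<le> V \<longrightarrow>
    \<bar>bump a 0 m 0 u v - (\<Sum>k<n. bump a k m 0 u 1 / fact k * (v - 1) ^ k)\<bar> \<le> B * \<bar>v - 1\<bar> ^ n"
proof -
  obtain B where B: "\<And>(u::'a) v. norm u \<le> R \<Longrightarrow> \<bar>v\<bar> \<le> V + 1 \<Longrightarrow> \<bar>bump a n m 0 u v\<bar> \<le> B"
    using bounded_bump[of n 0 a R "V + 1" m] assms by auto
  have "\<bar>bump a 0 m 0 u v - (\<Sum>k<n. bump a k m 0 u 1 / fact k * (v - 1) ^ k)\<bar>
      \<le> max 0 B * \<bar>v - 1\<bar> ^ n" if u: "norm u \<le> R" and v: "\<bar>v - 1\<bar> \<le> V" for u :: 'a and v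
  proof -
    define diff where "diff k t = bump a k m 0 u (1 + t)" for k t
    have D: "DERIV (diff k) t :> diff (Suc k) t" if "k < n" for k t
    proof -
      have "(bump a k m 0 u has_real_derivative bump a (Suc k) m 0 u (1 + t)) (at (1 + t))"
        using assms that by (intro DERIV_bump) auto
      then have "((\<lambda>t. bump a k m 0 u (1 + t)) has_real_derivative
          bump a (Suc k) m 0 u (1 + t) * 1) (at t)"
        by (rule DERIV_chain2) (auto intro!: derivative_eq_intros)
      then show ?thesis by (simp add: diff_def[abs_def] del: bump.simps)
    qed
    have "\<exists>t. \<bar>t\<bar> \<le> \<bar>v - 1\<bar> \<and> diff 0 (v - 1)
        = (\<Sum>k<n. diff k 0 / fact k * (v - 1) ^ k) + diff n t / fact n * (v - 1) ^ n"
      by (rule Maclaurin_bi_le) (use D in auto)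
    then obtain t where t: "\<bar>t\<bar> \<le> \<bar>v - 1\<bar>" and eq: "diff 0 (v - 1)
        = (\<Sum>k<n. diff k 0 / fact k * (v - 1) ^ k) + diff n t / fact n * (v - 1) ^ n"
      by blast
    have "\<bar>diff n t\<bar> \<le> B" unfolding diff_def using u v t by (intro B) auto
    then have "\<bar>diff n t / fact n * (v - 1) ^ n\<bar> \<le> max 0 B * \<bar>v - 1\<bar> ^ n"
      by (rule taylor_remainder_bound)
    then show ?thesis using eq by (simp add: diff_def del: bump.simps)
  qed
  then show ?thesis by (intro exI[of _ "max 0 B"]) auto
qed

text \<open>The indicator of the unit ball in the kernel becomes the positive part in \<^const>\<open>bump\<close>.\<close>

lemma beta_kernel_eq_bump:
  "v ^ m * beta_kernel a (v *\<^sub>R u :: real ^ 'd) =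
     bump a 0 m 0 u v / beta_normaliser TYPE('d) a"
proof -
  have eq: "(v *\<^sub>R u) \<bullet> (v *\<^sub>R u) = v\<^sup>2 * (u \<bullet> u)"
    by (simp add: power2_eq_square)
  have "v *\<^sub>R u \<in> cball 0 1 \<longleftrightarrow> v\<^sup>2 * (u \<bullet> u) \<le> 1"
    unfolding eq[symmetric] by (simp add: dot_square_norm abs_square_le_1)
  then show ?thesis
    unfolding beta_kernel_def eq by (auto simp: max_def)
qed

lemma g_fun_eq_bump:
  "g_fun a (u :: real ^ 'd) v = bump a 0 (CARD('d) + 2) 0 u v / beta_normaliser TYPE('d) a"
  unfolding g_fun_def by (rule beta_kernel_eq_bump)

lemma deriv_g_fun:
  assumes "a > real k"
  shows "(deriv ^^ k) (g_fun a (u :: real ^ 'd)) =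
     (\<lambda>v. bump a k (CARD('d) + 2) 0 u v / beta_normaliser TYPE('d) a)"
  using assms
proof (induction k)
  case 0
  then show ?case by (auto simp: g_fun_eq_bump simp del: bump.simps)
next
  case (Suc k)
  have "deriv (\<lambda>v. bump a k (CARD('d) + 2) 0 u v / beta_normaliser TYPE('d) a) v =
      bump a (Suc k) (CARD('d) + 2) 0 u v / beta_normaliser TYPE('d) a" for v
    by (intro DERIV_imp_deriv DERIV_cdivide DERIV_bump) (use Suc.prems in auto)
  with Suc show ?case by (auto simp del: bump.simps)
qed

lemma beta_normaliser_pos:
  assumes "a > 0"
  shows "beta_normaliser TYPE('d::finite) a > 0"
proof -
  have int: "integrable lborel (\<lambda>x :: real ^ 'd. indicator (cball 0 1) x *\<^sub>R (1 - x \<bullet> x) powr a)"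
    by (rule borel_integrable_compact)
      (use assms in \<open>auto intro!: continuous_intros continuous_on_powr' simp: dot_square_norm abs_square_le_1\<close>)
  have "0 < (3/4) powr a * measure lborel (cball (0 :: real ^ 'd) (1/2))"
    by (auto simp: content_cball_pos)
  also have "\<dots> = (LINT x|lborel. indicator (cball (0 :: real ^ 'd) (1/2)) x *\<^sub>R (3/4) powr a)"
    by simp
  also have "\<dots> \<le> (LINT x|lborel. indicator (cball (0 :: real ^ 'd) 1) x *\<^sub>R (1 - x \<bullet> x) powr a)"
  proof (rule integral_mono[OF _ int])
    show "integrable lborel (\<lambda>x :: real ^ 'd. indicator (cball 0 (1/2)) x *\<^sub>R (3/4) powr a)"
      by (rule borel_integrable_compact) auto
    fix x :: "real ^ 'd"
    show "indicator (cball 0 (1/2)) x *\<^sub>R (3/4) powr a \<le> indicator (cball 0 1) x *\<^sub>R (1 - x \<bullet> x) powr a"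
    proof (cases "x \<in> cball 0 (1/2)")
      case True
      then have "(norm x)\<^sup>2 \<le> (1/2)\<^sup>2" by (intro power_mono) auto
      then have "(3/4) powr a \<le> (1 - x \<bullet> x) powr a"
        using assms by (intro powr_mono2) (auto simp: dot_square_norm power2_eq_square)
      with True show ?thesis by auto
    qed auto
  qed
  finally show ?thesis
    unfolding beta_normaliser_def set_lebesgue_integral_def .
qed

lemma integrable_continuous_compact_support:
  fixes f :: "'a::euclidean_space \<Rightarrow> real"
  assumes "continuous_on UNIV f" "\<And>x. norm x > R \<Longrightarrow> f x = 0"
  shows "integrable lborel f"
proof -
  have "integrable lborel (\<lambda>x. indicator (cball 0 R) x *\<^sub>R f x)"
    by (rule borel_integrable_compact) (auto intro: continuous_on_subset[OF assms(1)])
  also have "(\<lambda>x. indicator (cball 0 R) x *\<^sub>R f x) = f"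
    using assms(2) by (auto simp: indicator_def fun_eq_iff)
  finally show ?thesis .
qed

lemma integral_beta_kernel:
  assumes "a > 0"
  shows "(LINT u|lborel. beta_kernel a (u :: real ^ 'd)) = 1"
proof -
  have "(LINT u|lborel. beta_kernel a (u :: real ^ 'd))
      = (LINT (u :: real ^ 'd)|lborel. (indicator (cball 0 1) u *\<^sub>R (1 - u \<bullet> u) powr a) / beta_normaliser TYPE('d) a)"
    unfolding beta_kernel_def[abs_def] by (rule Bochner_Integration.integral_cong) auto
  also have "\<dots> = 1"
    unfolding integral_divide_zero using beta_normaliser_pos[OF assms, where 'd='d]
    by (simp add: beta_normaliser_def set_lebesgue_integral_def)
  finally show ?thesis .
qed

section \<open>Taylor expansion along lines from partial derivatives\<close>

abbreviation has_partials_on :: "(real ^ 'd \<Rightarrow> real) \<Rightarrow> (real ^ 'd) set \<Rightarrow> bool" where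
  "has_partials_on f W \<equiv> \<forall>j. \<forall>x\<in>W. (\<lambda>t. f (x + t *\<^sub>R axis j 1)) differentiable (at 0)"

text \<open>Iterated partial derivatives apply the last index first, so peeling off the last index gives the
  recursion on the order of smoothness used in all inductions below.\<close>

lemma partial_derivatives_snoc:
  "partial_derivatives (js @ [j]) f = partial_derivatives js (partial_derivative j f)"
  by (simp add: partial_derivatives_def)

lemma times_continuously_differentiable_on_0:
  "times_continuously_differentiable_on 0 f W \<longleftrightarrow> continuous_on W f"
  by (simp add: times_continuously_differentiable_on_def partial_derivatives_def)

lemma times_continuously_differentiable_on_Suc:
  "times_continuously_differentiable_on (Suc k) f W \<longleftrightarrow>
     continuous_on W f \<and> has_partials_on f W \<and>
     (\<forall>j. times_continuously_differentiable_on k (partial_derivative j f) W)"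
proof -
  have all_lists: "(\<forall>js :: 'a list. P js) \<longleftrightarrow> P [] \<and> (\<forall>j js. P (js @ [j]))" for P
    by (metis rev_exhaust)
  show ?thesis
    unfolding times_continuously_differentiable_on_def
      all_lists[of "\<lambda>js. length js < Suc k \<longrightarrow> _ js"] all_lists[of "\<lambda>js. length js \<le> Suc k \<longrightarrow> _ js"]
      partial_derivatives_snoc
    by (auto simp: partial_derivatives_def)
qed

lemma times_continuously_differentiable_on_SucD:
  "times_continuously_differentiable_on (Suc k) f W \<Longrightarrow> times_continuously_differentiable_on k f W"
  by (auto simp: times_continuously_differentiable_on_def)

lemma times_continuously_differentiable_on_imp_continuous_on:
  "times_continuously_differentiable_on k f W \<Longrightarrow> continuous_on W f"
  unfolding times_continuously_differentiable_on_def
  by (elim conjE allE[of _ "[]"]) (simp add: partial_derivatives_def)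

lemma eventually_line_in_open:
  fixes W :: "'a::real_normed_vector set"
  assumes "open W" "x + t *\<^sub>R e \<in> W"
  shows "\<forall>\<^sub>F s in nhds t. x + s *\<^sub>R e \<in> W"
proof -
  have "((\<lambda>s. x + s *\<^sub>R e) \<longlongrightarrow> x + t *\<^sub>R e) (nhds t)"
    by (intro tendsto_intros) (simp add: tendsto_ident_at filterlim_ident)
  then show ?thesis by (rule topological_tendstoD) (use assms in auto)
qed

lemma partial_derivative_cong:
  fixes x :: "real ^ 'd"
  assumes "open W" "x \<in> W" "\<And>y. y \<in> W \<Longrightarrow> f y = g y"
  shows "partial_derivative j f x = partial_derivative j g x"
    and "(\<lambda>t. f (x + t *\<^sub>R axis j 1)) differentiable (at 0) \<longleftrightarrow>
         (\<lambda>t. g (x + t *\<^sub>R axis j 1)) differentiable (at 0)"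
proof -
  have ev: "\<forall>\<^sub>F t in nhds 0. f (x + t *\<^sub>R axis j 1) = g (x + t *\<^sub>R axis j 1)"
    using eventually_line_in_open[of W x 0 "axis j 1"] assms by (auto elim!: eventually_mono)
  then show "partial_derivative j f x = partial_derivative j g x"
    unfolding partial_derivative_def by (intro deriv_cong_ev) auto
  have "((\<lambda>t. f (x + t *\<^sub>R axis j 1)) has_real_derivative D) (at 0) \<longleftrightarrow>
      ((\<lambda>t. g (x + t *\<^sub>R axis j 1)) has_real_derivative D) (at 0)" for D
    using ev by (intro DERIV_cong_ev) auto
  then show "(\<lambda>t. f (x + t *\<^sub>R axis j 1)) differentiable (at 0) \<longleftrightarrow>
         (\<lambda>t. g (x + t *\<^sub>R axis j 1)) differentiable (at 0)"
    by (simp add: real_differentiable_def)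
qed

lemma partial_derivatives_cong:
  fixes x :: "real ^ 'd"
  assumes "open W" "x \<in> W" "\<And>y. y \<in> W \<Longrightarrow> f y = g y"
  shows "partial_derivatives js f x = partial_derivatives js g x"
  using assms(2)
proof (induction js arbitrary: x)
  case Nil
  then show ?case using assms(3) by (simp add: partial_derivatives_def)
next
  case (Cons j js)
  then show ?case
    using partial_derivative_cong(1)[OF assms(1) Cons.prems, of "partial_derivatives js f" "partial_derivatives js g" j]
    by (simp add: partial_derivatives_def)
qed

lemma times_continuously_differentiable_on_cong:
  assumes "open W" "\<And>y. y \<in> W \<Longrightarrow> f y = g y"
  shows "times_continuously_differentiable_on k f W \<longleftrightarrow> times_continuously_differentiable_on k g W"
proof -
  have eq: "partial_derivatives js f y = partial_derivatives js g y" if "y \<in> W" for js y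
    using assms that by (intro partial_derivatives_cong) auto
  have "continuous_on W (partial_derivatives js f) \<longleftrightarrow> continuous_on W (partial_derivatives js g)" for js
    by (rule continuous_on_cong) (auto simp: eq)
  moreover have "(\<lambda>t. partial_derivatives js f (x + t *\<^sub>R axis j 1)) differentiable (at 0) \<longleftrightarrow>
      (\<lambda>t. partial_derivatives js g (x + t *\<^sub>R axis j 1)) differentiable (at 0)" if "x \<in> W" for x js j
    using that by (intro partial_derivative_cong(2)[OF assms(1)]) (auto simp: eq)
  ultimately show ?thesis unfolding times_continuously_differentiable_on_def by auto
qed

lemma has_partials_onD:
  assumes "has_partials_on f W" "x + t *\<^sub>R axis j 1 \<in> W"
  shows "((\<lambda>s. f (x + s *\<^sub>R axis j 1)) has_real_derivative
           partial_derivative j f (x + t *\<^sub>R axis j 1)) (at t)"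
proof -
  let ?x = "x + t *\<^sub>R axis j 1"
  have "(\<lambda>s. f (?x + s *\<^sub>R axis j 1)) differentiable (at 0)"
    using assms by blast
  then have "((\<lambda>s. f (?x + s *\<^sub>R axis j 1)) has_real_derivative partial_derivative j f ?x) (at (t - t))"
    unfolding partial_derivative_def by (simp add: DERIV_deriv_iff_real_differentiable)
  then have "((\<lambda>s. f (?x + (s - t) *\<^sub>R axis j 1)) has_real_derivative partial_derivative j f ?x * 1) (at t)"
    by (rule DERIV_chain2) (auto intro!: derivative_eq_intros)
  then show ?thesis by (simp add: algebra_simps)
qed

lemma partial_derivative_eqI:
  assumes "((\<lambda>t. f (x + t *\<^sub>R axis j 1)) has_real_derivative D) (at 0)"
  shows "partial_derivative j f x = D" "(\<lambda>t. f (x + t *\<^sub>R axis j 1)) differentiable (at 0)"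
  using assms DERIV_imp_deriv unfolding partial_derivative_def by (auto simp: real_differentiable_def)

lemma times_continuously_differentiable_on_cmult:
  assumes "open W" "times_continuously_differentiable_on k f W"
  shows "times_continuously_differentiable_on k (\<lambda>x. c * f x) W"
  using assms(2)
proof (induction k arbitrary: f)
  case 0
  then show ?case by (auto simp: times_continuously_differentiable_on_0 intro!: continuous_intros)
next
  case (Suc k)
  note S = Suc.prems[unfolded times_continuously_differentiable_on_Suc]
  have D: "((\<lambda>t. c * f (x + t *\<^sub>R axis j 1)) has_real_derivative c * partial_derivative j f x) (at 0)"
    if "x \<in> W" for x j
    using has_partials_onD[of W f x 0 j] S that by (intro DERIV_cmult) auto
  have "times_continuously_differentiable_on k (partial_derivative j (\<lambda>x. c * f x)) W" for j
    using S Suc.IH[of "partial_derivative j f"] partial_derivative_eqI(1)[OF D]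
    by (subst times_continuously_differentiable_on_cong[OF assms(1)]) auto
  then show ?case
    unfolding times_continuously_differentiable_on_Suc
    using S partial_derivative_eqI(2)[OF D] by (auto intro!: continuous_intros)
qed

lemma times_continuously_differentiable_on_add:
  assumes "open W" "times_continuously_differentiable_on k f W" "times_continuously_differentiable_on k g W"
  shows "times_continuously_differentiable_on k (\<lambda>x. f x + g x) W"
  using assms(2,3)
proof (induction k arbitrary: f g)
  case 0
  then show ?case by (auto simp: times_continuously_differentiable_on_0 intro!: continuous_intros)
next
  case (Suc k)
  note S = Suc.prems[unfolded times_continuously_differentiable_on_Suc]
  have D: "((\<lambda>t. f (x + t *\<^sub>R axis j 1) + g (x + t *\<^sub>R axis j 1)) has_real_derivative
      partial_derivative j f x + partial_derivative j g x) (at 0)"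
    if "x \<in> W" for x j
    using has_partials_onD[of W f x 0 j] has_partials_onD[of W g x 0 j] S that
    by (intro DERIV_add) auto
  have "times_continuously_differentiable_on k (partial_derivative j (\<lambda>x. f x + g x)) W" for j
    using S Suc.IH[of "partial_derivative j f" "partial_derivative j g"] partial_derivative_eqI(1)[OF D]
    by (subst times_continuously_differentiable_on_cong[OF assms(1)]) auto
  then show ?case
    unfolding times_continuously_differentiable_on_Suc
    using S partial_derivative_eqI(2)[OF D] by (auto intro!: continuous_intros)
qed

lemma times_continuously_differentiable_on_mult:
  assumes "open W" "times_continuously_differentiable_on k f W" "times_continuously_differentiable_on k g W"
  shows "times_continuously_differentiable_on k (\<lambda>x. f x * g x) W"
  using assms(2,3)
proof (induction k arbitrary: f g)
  case 0
  then show ?case by (auto simp: times_continuously_differentiable_on_0 intro!: continuous_intros)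
next
  case (Suc k)
  note S = Suc.prems[unfolded times_continuously_differentiable_on_Suc]
  note S' = Suc.prems[THEN times_continuously_differentiable_on_SucD]
  have D: "((\<lambda>t. f (x + t *\<^sub>R axis j 1) * g (x + t *\<^sub>R axis j 1)) has_real_derivative
      partial_derivative j f x * g x + f x * partial_derivative j g x) (at 0)"
    if "x \<in> W" for x j
    using DERIV_mult[OF has_partials_onD[of W f x 0 j] has_partials_onD[of W g x 0 j]] S that
    by (auto simp: algebra_simps)
  have "times_continuously_differentiable_on k
      (\<lambda>x. partial_derivative j f x * g x + f x * partial_derivative j g x) W" for j
    using S S' by (intro times_continuously_differentiable_on_add Suc.IH assms(1)) auto
  then have "times_continuously_differentiable_on k (partial_derivative j (\<lambda>x. f x * g x)) W" for j
    using partial_derivative_eqI(1)[OF D]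
    by (subst times_continuously_differentiable_on_cong[OF assms(1)]) auto
  then show ?case
    unfolding times_continuously_differentiable_on_Suc
    using S partial_derivative_eqI(2)[OF D] by (auto intro!: continuous_intros)
qed

text \<open>The partial derivative of \<open>f\<^sup>p\<close> is \<open>p f\<^sup>p\<^sup>-\<^sup>1\<close> times that of \<open>f\<close>: a product of functions one
  order less smooth, provided that the claim is proved for all exponents \<open>p\<close> at once.\<close>

lemma times_continuously_differentiable_on_powr:
  assumes "open W" "times_continuously_differentiable_on k f W" "\<And>x. x \<in> W \<Longrightarrow> f x > 0"
  shows "times_continuously_differentiable_on k (\<lambda>x. f x powr p) W"
  using assms(2)
proof (induction k arbitrary: p)
  case 0
  then show ?case using assms(3)
    by (force simp: times_continuously_differentiable_on_0 intro!: continuous_on_powr continuous_intros)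
next
  case (Suc k)
  note S = Suc.prems[unfolded times_continuously_differentiable_on_Suc]
  note S' = Suc.prems[THEN times_continuously_differentiable_on_SucD]
  have D: "((\<lambda>t. f (x + t *\<^sub>R axis j 1) powr p) has_real_derivative
      p * (f x powr (p - 1) * partial_derivative j f x)) (at 0)"
    if "x \<in> W" for x j
    using DERIV_chain2[OF has_real_derivative_powr[of "f (x + 0 *\<^sub>R axis j 1)" p] has_partials_onD[of W f x 0 j]]
      S that assms(3)
    by (auto simp: algebra_simps)
  have "times_continuously_differentiable_on k
      (\<lambda>x. p * (f x powr (p - 1) * partial_derivative j f x)) W" for j
    using S S' by (intro times_continuously_differentiable_on_mult
        times_continuously_differentiable_on_cmult Suc.IH assms(1)) auto
  then have "times_continuously_differentiable_on k (partial_derivative j (\<lambda>x. f x powr p)) W" for j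
    using partial_derivative_eqI(1)[OF D]
    by (subst times_continuously_differentiable_on_cong[OF assms(1)]) auto
  moreover have "continuous_on W (\<lambda>x. f x powr p)"
    using S assms(3) by (force intro!: continuous_on_powr continuous_intros)
  ultimately show ?case
    unfolding times_continuously_differentiable_on_Suc
    using partial_derivative_eqI(2)[OF D] by auto
qed

text \<open>Moving from \<open>y\<close> to \<open>y + v\<close> one coordinate at a time, with the mean value inequality for each
  coordinate. The base point \<open>y\<close> is not tied to \<open>x\<close>, only close to it, so that the induction can
  move it.\<close>

lemma coordinate_increment_bound:
  fixes f :: "real ^ 'd \<Rightarrow> real"
  assumes partials: "has_partials_on f (ball x r)"
    and close: "\<And>j y. y \<in> ball x r \<Longrightarrow> \<bar>partial_derivative j f y - partial_derivative j f x\<bar> \<le> e"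
    and "finite S" "norm (y - x) + (\<Sum>j\<in>S. \<bar>v j\<bar>) < r"
  shows "\<bar>f (y + (\<Sum>j\<in>S. v j *\<^sub>R axis j 1)) - f y - (\<Sum>j\<in>S. v j * partial_derivative j f x)\<bar>
     \<le> e * (\<Sum>j\<in>S. \<bar>v j\<bar>)"
  using assms(3,4)
proof (induction S rule: finite_induct)
  case empty
  then show ?case by simp
next
  case (insert i S)
  let ?z = "y + (\<Sum>j\<in>S. v j *\<^sub>R axis j 1)"
  have "norm (\<Sum>j\<in>S. v j *\<^sub>R (axis j 1 :: real ^ 'd)) \<le> (\<Sum>j\<in>S. \<bar>v j\<bar>)"
    by (rule sum_norm_le) simp
  then have z: "norm (?z - x) \<le> norm (y - x) + (\<Sum>j\<in>S. \<bar>v j\<bar>)"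
    using norm_triangle_ineq[of "y - x" "\<Sum>j\<in>S. v j *\<^sub>R axis j 1"] by (simp add: algebra_simps)
  have inb: "?z + t *\<^sub>R axis i 1 \<in> ball x r" if "\<bar>t\<bar> \<le> \<bar>v i\<bar>" for t
  proof -
    have "norm (?z + t *\<^sub>R axis i 1 - x) \<le> norm (?z - x) + \<bar>t\<bar>"
      using norm_triangle_ineq[of "?z - x" "t *\<^sub>R axis i 1"] by (simp add: algebra_simps)
    then show ?thesis using that z insert by (simp add: dist_norm norm_minus_commute)
  qed
  define \<phi> where "\<phi> t = f (?z + t *\<^sub>R axis i 1) - t * partial_derivative i f x" for t
  have D: "(\<phi> has_real_derivative
      partial_derivative i f (?z + t *\<^sub>R axis i 1) - partial_derivative i f x) (at t)"
    if "\<bar>t\<bar> \<le> \<bar>v i\<bar>" for t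
    unfolding \<phi>_def[abs_def] using has_partials_onD[OF partials inb[OF that]]
    by (auto intro!: derivative_eq_intros)
  have "norm (\<phi> (v i) - \<phi> 0) \<le> e * norm (v i - 0)"
  proof (rule field_differentiable_bound[of "{-\<bar>v i\<bar>..\<bar>v i\<bar>}"])
    fix t assume t: "t \<in> {-\<bar>v i\<bar>..\<bar>v i\<bar>}"
    then have t': "\<bar>t\<bar> \<le> \<bar>v i\<bar>" by auto
    show "(\<phi> has_field_derivative
      partial_derivative i f (?z + t *\<^sub>R axis i 1) - partial_derivative i f x) (at t within {-\<bar>v i\<bar>..\<bar>v i\<bar>})"
      using D[OF t'] by (rule has_field_derivative_at_within)
    show "norm (partial_derivative i f (?z + t *\<^sub>R axis i 1) - partial_derivative i f x) \<le> e"
      using close[OF inb[OF t']] by simp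
  qed auto
  then have "\<bar>f (?z + v i *\<^sub>R axis i 1) - f ?z - v i * partial_derivative i f x\<bar> \<le> e * \<bar>v i\<bar>"
    by (simp add: \<phi>_def algebra_simps)
  moreover have "\<bar>f ?z - f y - (\<Sum>j\<in>S. v j * partial_derivative j f x)\<bar> \<le> e * (\<Sum>j\<in>S. \<bar>v j\<bar>)"
    using insert by (intro insert.IH) auto
  moreover have "f (y + (\<Sum>j\<in>insert i S. v j *\<^sub>R axis j 1)) = f (?z + v i *\<^sub>R axis i 1)"
    using insert by (simp add: algebra_simps)
  ultimately show ?case using insert(1,2) by (simp add: algebra_simps)
qed

text \<open>Continuity of the partial derivatives makes the error in the increment bound \<open>o(|s|)\<close> along the
  line.\<close>

lemma DERIV_along_line:
  fixes f :: "real ^ 'd \<Rightarrow> real"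
  assumes "open W" and partials: "has_partials_on f W"
    and cont: "\<And>j. continuous_on W (partial_derivative j f)"
    and xW: "x + t *\<^sub>R u \<in> W"
  shows "((\<lambda>s. f (x + s *\<^sub>R u)) has_real_derivative
           (\<Sum>j\<in>UNIV. u $ j * partial_derivative j f (x + t *\<^sub>R u))) (at t)"
proof -
  let ?x = "x + t *\<^sub>R u" and ?U = "\<Sum>j\<in>UNIV. \<bar>u $ j\<bar>"
  let ?D = "\<Sum>j\<in>UNIV. u $ j * partial_derivative j f ?x"
  have U: "?U \<ge> 0" by (simp add: sum_nonneg)
  have "((\<lambda>s. (f (?x + s *\<^sub>R u) - f ?x) / s) \<longlongrightarrow> ?D) (at 0)"
  proof (rule tendstoI)
    fix e :: real assume "e > 0"
    \<comment> \<open>Chosen so that \<open>e' * ?U < e\<close>, also when \<open>u = 0\<close>.\<close>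
    define e' where "e' = e / (2 * (?U + 1))"
    have e': "e' > 0" unfolding e'_def using \<open>e > 0\<close> U by (intro divide_pos_pos mult_pos_pos add_nonneg_pos) auto
    have "\<forall>\<^sub>F y in nhds ?x. \<bar>partial_derivative j f y - partial_derivative j f ?x\<bar> < e'" for j
    proof -
      have "isCont (partial_derivative j f) ?x"
        using cont xW assms(1) by (simp add: continuous_on_eq_continuous_at)
      then have "(partial_derivative j f \<longlongrightarrow> partial_derivative j f ?x) (nhds ?x)"
        by (simp add: continuous_at tendsto_at_iff_tendsto_nhds)
      from tendstoD[OF this e'] show ?thesis by (simp add: dist_real_def)
    qed
    then have "\<forall>\<^sub>F y in nhds ?x. y \<in> W \<and> (\<forall>j. \<bar>partial_derivative j f y - partial_derivative j f ?x\<bar> < e')"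
      using eventually_nhds_in_open[OF assms(1) xW] by (simp add: eventually_conj_iff eventually_all_finite)
    then obtain r where r: "r > 0" and
      rb: "\<And>y. dist y ?x < r \<Longrightarrow> y \<in> W \<and> (\<forall>j. \<bar>partial_derivative j f y - partial_derivative j f ?x\<bar> < e')"
      unfolding eventually_nhds_metric by blast
    show "\<forall>\<^sub>F s in at 0. dist ((f (?x + s *\<^sub>R u) - f ?x) / s) ?D < e"
      unfolding eventually_at
    proof (intro exI[of _ "r / (?U + 1)"] conjI ballI impI)
      show "r / (?U + 1) > 0" using r U by (intro divide_pos_pos add_nonneg_pos) auto
      fix s :: real assume s: "s \<noteq> 0 \<and> dist s 0 < r / (?U + 1)"
      have lt: "\<bar>s\<bar> * ?U < r"
      proof -
        have "\<bar>s\<bar> * ?U \<le> \<bar>s\<bar> * (?U + 1)" by (intro mult_left_mono) auto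
        also have "\<dots> < r" using s U by (simp add: field_simps)
        finally show ?thesis .
      qed
      have su: "(\<Sum>j\<in>UNIV. (s * u $ j) *\<^sub>R axis j 1) = s *\<^sub>R u"
        by (simp add: vec_eq_iff axis_def if_distrib sum.delta cong: if_cong)
      have "\<bar>f (?x + (\<Sum>j\<in>UNIV. (s * u $ j) *\<^sub>R axis j 1)) - f ?x - (\<Sum>j\<in>UNIV. (s * u $ j) * partial_derivative j f ?x)\<bar>
           \<le> e' * (\<Sum>j\<in>UNIV. \<bar>s * u $ j\<bar>)"
      proof (rule coordinate_increment_bound[where r=r])
        show "has_partials_on f (ball ?x r)"
          using partials rb by (auto simp: dist_commute)
        show "\<bar>partial_derivative j f y - partial_derivative j f ?x\<bar> \<le> e'" if "y \<in> ball ?x r" for j y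
          using rb[of y] that by (auto simp: dist_commute less_imp_le)
        show "norm (?x - ?x) + (\<Sum>j\<in>UNIV. \<bar>s * u $ j\<bar>) < r"
          using lt by (simp add: abs_mult sum_distrib_left)
      qed simp
      then have "\<bar>f (?x + s *\<^sub>R u) - f ?x - s * ?D\<bar> \<le> e' * (\<bar>s\<bar> * ?U)"
        unfolding su by (simp add: abs_mult sum_distrib_left mult.assoc)
      also have "\<dots> < \<bar>s\<bar> * e"
      proof -
        have "e' * ?U < e' * (2 * (?U + 1))"
        proof (rule mult_strict_left_mono[OF _ e'])
          have "s < 2 * (s + 1)" if "s \<ge> 0" for s :: real using that by simp
          from this[OF U] show "?U < 2 * (?U + 1)" .
        qed
        also have "\<dots> = e"
        proof -
          have "e / (2 * (s + 1)) * (2 * (s + 1)) = e" if "s \<ge> 0" for s :: real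
            using that by (simp add: field_simps)
          from this[OF U] show ?thesis unfolding e'_def .
        qed
        finally have "e' * ?U < e" .
        then have "\<bar>s\<bar> * (e' * ?U) < \<bar>s\<bar> * e"
          using s by (intro mult_strict_left_mono) auto
        then show ?thesis by (simp add: algebra_simps)
      qed
      finally have "\<bar>(f (?x + s *\<^sub>R u) - f ?x - s * ?D) / s\<bar> < e"
        using s by (simp add: abs_divide divide_less_eq mult.commute)
      moreover have "(f (?x + s *\<^sub>R u) - f ?x - s * ?D) / s = (f (?x + s *\<^sub>R u) - f ?x) / s - ?D"
        using s by (simp add: diff_divide_distrib)
      ultimately show "dist ((f (?x + s *\<^sub>R u) - f ?x) / s) ?D < e"
        by (simp add: dist_real_def)
    qed
  qed
  then show ?thesis
    by (simp add: DERIV_def algebra_simps)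
qed

text \<open>The form in which the derivative along the line \<open>s \<mapsto> x + s u\<close> produces the next order.\<close>

lemma diagonal_derivative_Suc:
  fixes u :: "real ^ 'd"
  shows "diagonal_derivative (Suc r) f x u =
    (\<Sum>js\<in>{js :: 'd list. length js = r}. prod_list (map (($) u) js) *
       (\<Sum>j\<in>UNIV. u $ j * partial_derivative j (partial_derivatives js f) x))"
proof -
  have "{js :: 'd list. length js = Suc r} = (\<lambda>(js, j). j # js) ` ({js. length js = r} \<times> UNIV)"
    by (auto simp: length_Suc_conv)
  moreover have "inj_on (\<lambda>(js, j). j # js) ({js :: 'd list. length js = r} \<times> UNIV)"
    by (auto simp: inj_on_def)
  ultimately have "diagonal_derivative (Suc r) f x u =
    (\<Sum>(js, j)\<in>{js :: 'd list. length js = r} \<times> UNIV.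
       prod_list (map (($) u) (j # js)) * partial_derivatives (j # js) f x)"
    unfolding diagonal_derivative_def by (simp add: sum.reindex case_prod_unfold o_def)
  then show ?thesis
    by (simp add: sum.cartesian_product[symmetric] partial_derivatives_def sum_distrib_left algebra_simps)
qed

lemma diagonal_derivative_0: "diagonal_derivative 0 f x u = f x"
  by (simp add: diagonal_derivative_def partial_derivatives_def)

lemma DERIV_diagonal_derivative:
  fixes u :: "real ^ 'd"
  assumes "open W" "times_continuously_differentiable_on k f W" "r < k" "x + t *\<^sub>R u \<in> W"
  shows "((\<lambda>s. diagonal_derivative r f (x + s *\<^sub>R u) u) has_real_derivative
           diagonal_derivative (Suc r) f (x + t *\<^sub>R u) u) (at t)"
  unfolding diagonal_derivative_Suc unfolding diagonal_derivative_def
proof (intro DERIV_sum DERIV_cmult DERIV_along_line[OF assms(1) _ _ assms(4)])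
  fix js :: "'d list" assume js: "js \<in> {js. length js = r}"
  with assms(2,3) show "has_partials_on (partial_derivatives js f) W"
    unfolding times_continuously_differentiable_on_def by auto
  fix j
  have "continuous_on W (partial_derivatives (j # js) f)"
    using assms(2,3) js unfolding times_continuously_differentiable_on_def by auto
  then show "continuous_on W (partial_derivative j (partial_derivatives js f))"
    by (simp add: partial_derivatives_def)
qed

lemma diagonal_derivative_scaleR:
  "diagonal_derivative r f x (c *\<^sub>R u) = c ^ r * diagonal_derivative r f x u"
proof -
  have "prod_list (map (\<lambda>j. c * u $ j) js) = c ^ length js * prod_list (map (\<lambda>j. u $ j) js)" for js
    by (induction js) (auto simp: algebra_simps)
  then show ?thesis by (simp add: diagonal_derivative_def sum_distrib_left algebra_simps)
qed

lemma continuous_on_diagonal_derivative: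
  fixes f :: "real ^ 'd \<Rightarrow> real"
  assumes "times_continuously_differentiable_on k f W" "r \<le> k"
  shows "continuous_on (W \<times> UNIV) (\<lambda>(x, u). diagonal_derivative r f x u)"
proof -
  have "continuous_on W (partial_derivatives js f)" if "length js = r" for js
    using assms that unfolding times_continuously_differentiable_on_def by auto
  then have "continuous_on (W \<times> (UNIV :: (real ^ 'd) set)) (\<lambda>p. partial_derivatives js f (fst p))" if "length js = r" for js
    using that by (auto intro!: continuous_on_compose2[of W "partial_derivatives js f" _ fst] continuous_on_fst continuous_on_id)
  moreover have "continuous_on (W \<times> UNIV) (\<lambda>p. prod_list (map (\<lambda>j. (snd p :: real ^ 'd) $ j) js))" for js
    by (induction js) (auto intro!: continuous_intros)
  ultimately show ?thesis
    unfolding diagonal_derivative_def case_prod_unfold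
    by (intro continuous_on_sum continuous_on_mult) auto
qed

text \<open>The one-dimensional Taylor formula along each line; the highest derivative is bounded uniformly
  because points and directions range over compact sets.\<close>

lemma line_taylor:
  fixes f :: "real ^ 'd \<Rightarrow> real"
  assumes "open W" "times_continuously_differentiable_on n f W" and R: "R \<ge> 0"
    and r: "cball x r \<subseteq> W"
  shows "\<exists>B\<ge>0. \<forall>u t. norm u \<le> R \<longrightarrow> \<bar>t\<bar> * R \<le> r \<longrightarrow>
    \<bar>f (x + t *\<^sub>R u) - (\<Sum>k<n. diagonal_derivative k f x u / fact k * t ^ k)\<bar> \<le> B * \<bar>t\<bar> ^ n"
proof -
  have "compact ((\<lambda>(y, u). diagonal_derivative n f y u) ` (cball x r \<times> cball 0 R))"
    by (intro compact_continuous_image compact_Times compact_cball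
        continuous_on_subset[OF continuous_on_diagonal_derivative[OF assms(2)]]) (use r in auto)
  then obtain B where "\<forall>z \<in> (\<lambda>(y, u). diagonal_derivative n f y u) ` (cball x r \<times> cball 0 R). norm z \<le> B"
    using compact_imp_bounded bounded_iff by metis
  then have B: "\<bar>diagonal_derivative n f y u\<bar> \<le> B" if "y \<in> cball x r" "norm u \<le> R" for y u
    using that by force
  have "\<bar>f (x + t *\<^sub>R u) - (\<Sum>k<n. diagonal_derivative k f x u / fact k * t ^ k)\<bar> \<le> max 0 B * \<bar>t\<bar> ^ n"
    if u: "norm u \<le> R" and t: "\<bar>t\<bar> * R \<le> r" for u t
  proof -
    have inb: "x + s *\<^sub>R u \<in> cball x r" if "\<bar>s\<bar> \<le> \<bar>t\<bar>" for s
    proof -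
      have "\<bar>s\<bar> * norm u \<le> \<bar>t\<bar> * R" using that u R by (intro mult_mono) auto
      then show ?thesis using t by (simp add: dist_norm)
    qed
    have "\<exists>s. \<bar>s\<bar> \<le> \<bar>t\<bar> \<and> diagonal_derivative 0 f (x + t *\<^sub>R u) u
        = (\<Sum>k<n. diagonal_derivative k f (x + 0 *\<^sub>R u) u / fact k * t ^ k)
          + diagonal_derivative n f (x + s *\<^sub>R u) u / fact n * t ^ n"
      by (rule Maclaurin_bi_le[where diff="\<lambda>k s. diagonal_derivative k f (x + s *\<^sub>R u) u"])
        (use inb r in \<open>auto intro!: DERIV_diagonal_derivative[OF assms(1,2)]\<close>)
    then obtain s where s: "\<bar>s\<bar> \<le> \<bar>t\<bar>" and eq: "diagonal_derivative 0 f (x + t *\<^sub>R u) u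
        = (\<Sum>k<n. diagonal_derivative k f (x + 0 *\<^sub>R u) u / fact k * t ^ k)
          + diagonal_derivative n f (x + s *\<^sub>R u) u / fact n * t ^ n" by blast
    have "\<bar>diagonal_derivative n f (x + s *\<^sub>R u) u\<bar> \<le> B"
      using B[OF inb[OF s] u] .
    then have "\<bar>diagonal_derivative n f (x + s *\<^sub>R u) u / fact n * t ^ n\<bar> \<le> max 0 B * \<bar>t\<bar> ^ n"
      by (rule taylor_remainder_bound)
    then show ?thesis using eq by (simp add: diagonal_derivative_0)
  qed
  then show ?thesis by (intro exI[of _ "max 0 B"]) auto
qed

section \<open>Composition of Taylor expansions\<close>

lemma bounded_const_comp: "bounded ((\<lambda>_. c :: real) ` S)"
  by (rule bounded_subset[of "{c}"]) auto

lemma bounded_mult_comp: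
  fixes f g :: "'i \<Rightarrow> real"
  assumes "bounded (f ` S)" "bounded (g ` S)"
  shows "bounded ((\<lambda>i. f i * g i) ` S)"
proof -
  obtain a b where "\<forall>i\<in>S. norm (f i) \<le> a" "\<forall>i\<in>S. norm (g i) \<le> b"
    using assms by (auto simp: bounded_iff)
  then have "\<forall>i\<in>S. norm (f i * g i) \<le> a * b"
    by (auto simp: abs_mult intro!: mult_mono order_trans[OF abs_ge_zero])
  then show ?thesis by (auto simp: bounded_iff)
qed

lemma bounded_power_comp:
  fixes f :: "'i \<Rightarrow> real"
  assumes "bounded (f ` S)"
  shows "bounded ((\<lambda>i. f i ^ n) ` S)"
  by (induction n) (auto intro!: bounded_const_comp bounded_mult_comp[OF assms])

lemma abs_diff_triangle: "\<bar>x - y\<bar> \<le> a \<Longrightarrow> \<bar>y - z\<bar> \<le> b \<Longrightarrow> \<bar>x - z\<bar> \<le> a + (b :: real)"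
  by linarith

text \<open>Substituting the expansion of \<open>w\<close> in powers of \<open>x\<close> into that of \<open>F\<close> in powers of \<open>w\<close>. The remainder of
  \<open>w\<close> is written as \<open>x\<^sup>5 \<rho>\<close> with \<open>\<rho>\<close> bounded; then \<open>w = x P1\<close> for a nested (Horner) form of bounded
  functions, and every power of \<open>w\<close> equals its truncation plus \<open>x\<^sup>5\<close> times a polynomial in bounded
  functions, which is bounded. The index set keeps the constants uniform.\<close>

lemma taylor_compose_order_4:
  fixes x w F a1 a2 a3 a4 d0 d1 d2 d3 d4 :: "'i \<Rightarrow> real"
  assumes bdd: "bounded (x ` S)" "bounded (a1 ` S)" "bounded (a2 ` S)" "bounded (a3 ` S)" "bounded (a4 ` S)"
      "bounded (d1 ` S)" "bounded (d2 ` S)" "bounded (d3 ` S)" "bounded (d4 ` S)"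
    and w: "\<And>i. i \<in> S \<Longrightarrow> \<bar>w i - (a1 i * x i + a2 i / 2 * x i ^ 2 + a3 i / 6 * x i ^ 3 + a4 i / 24 * x i ^ 4)\<bar>
       \<le> B1 * \<bar>x i\<bar> ^ 5"
    and F: "\<And>i. i \<in> S \<Longrightarrow> \<bar>F i - (d0 i + d1 i * w i + d2 i / 2 * w i ^ 2 + d3 i / 6 * w i ^ 3 + d4 i / 24 * w i ^ 4)\<bar>
       \<le> B2 * \<bar>w i\<bar> ^ 5"
  shows "\<exists>B. \<forall>i\<in>S. \<bar>F i - (d0 i + d1 i * a1 i * x i
      + (d1 i * a2 i / 2 + d2 i * a1 i ^ 2 / 2) * x i ^ 2
      + (d1 i * a3 i / 6 + d2 i * a1 i * a2 i / 2 + d3 i * a1 i ^ 3 / 6) * x i ^ 3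
      + (d1 i * a4 i / 24 + d2 i / 2 * (a1 i * a3 i / 3 + a2 i ^ 2 / 4)
         + d3 i / 4 * a1 i ^ 2 * a2 i + d4 i / 24 * a1 i ^ 4) * x i ^ 4)\<bar> \<le> B * \<bar>x i\<bar> ^ 5"
proof -
  define q where "q i = a1 i * x i + a2 i / 2 * x i ^ 2 + a3 i / 6 * x i ^ 3 + a4 i / 24 * x i ^ 4" for i
  define \<rho> where "\<rho> i = (w i - q i) / x i ^ 5" for i
  \<comment> \<open>Horner form: \<open>P4\<close> to \<open>P1\<close> are successive tails of \<open>w / x\<close>.\<close>
  define P4 where "P4 i = a4 i / 24 + x i * \<rho> i" for i
  define P3 where "P3 i = a3 i / 6 + x i * P4 i" for i
  define P2 where "P2 i = a2 i / 2 + x i * P3 i" for i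
  define P1 where "P1 i = a1 i + x i * P2 i" for i
  define E2 where "E2 i = 2 * a1 i * P4 i + a2 i * P3 i + x i * P3 i ^ 2" for i
  define E3 where "E3 i = 3 * a1 i ^ 2 * P3 i + 3 * a1 i * P2 i ^ 2 + x i * P2 i ^ 3" for i
  define E4 where "E4 i = 4 * a1 i ^ 3 * P2 i + 6 * a1 i ^ 2 * x i * P2 i ^ 2
      + 4 * a1 i * x i ^ 2 * P2 i ^ 3 + x i ^ 3 * P2 i ^ 4" for i
  define E where "E i = d1 i * \<rho> i + d2 i * E2 i / 2 + d3 i * E3 i / 6 + d4 i * E4 i / 24" for i
  have wx: "w i = x i * P1 i" if "i \<in> S" for i
  proof -
    have "w i = q i + \<rho> i * x i ^ 5"
      using w[OF that] by (cases "x i = 0") (auto simp: \<rho>_def q_def)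
    then show ?thesis
      by (simp add: q_def P1_def P2_def P3_def P4_def algebra_simps power2_eq_square power3_eq_cube power_numeral_reduce)
  qed
  have \<rho>: "\<bar>\<rho> i\<bar> \<le> \<bar>B1\<bar>" if "i \<in> S" for i
  proof (cases "x i = 0")
    case False
    have "\<bar>w i - q i\<bar> \<le> \<bar>B1\<bar> * \<bar>x i\<bar> ^ 5"
      using w[OF that] unfolding q_def by (rule order_trans) (auto intro!: mult_right_mono)
    then show ?thesis using False by (simp add: \<rho>_def abs_divide power_abs divide_le_eq)
  qed (simp add: \<rho>_def)
  have b\<rho>: "bounded (\<rho> ` S)"
    using \<rho> by (auto simp: bounded_iff)
  note bi = bounded_const_comp bounded_mult_comp bounded_plus_comp bounded_power_comp bdd b\<rho>
  have bP4: "bounded (P4 ` S)"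
    unfolding P4_def[abs_def] divide_inverse by (intro bi)
  have bP3: "bounded (P3 ` S)"
    unfolding P3_def[abs_def] divide_inverse by (intro bi bP4)
  have bP2: "bounded (P2 ` S)"
    unfolding P2_def[abs_def] divide_inverse by (intro bi bP3)
  have bP1: "bounded (P1 ` S)"
    unfolding P1_def[abs_def] divide_inverse by (intro bi bP2)
  have "bounded (E ` S)"
    unfolding E_def[abs_def] E2_def E3_def E4_def divide_inverse by (intro bi bP2 bP3 bP4)
  then obtain BE where BE: "\<And>i. i \<in> S \<Longrightarrow> \<bar>E i\<bar> \<le> BE"
    by (auto simp: bounded_iff)
  obtain BP where BP: "\<And>i. i \<in> S \<Longrightarrow> \<bar>P1 i\<bar> \<le> BP"
    using bP1 by (auto simp: bounded_iff)
  have "\<bar>F i - (d0 i + d1 i * a1 i * x i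
      + (d1 i * a2 i / 2 + d2 i * a1 i ^ 2 / 2) * x i ^ 2
      + (d1 i * a3 i / 6 + d2 i * a1 i * a2 i / 2 + d3 i * a1 i ^ 3 / 6) * x i ^ 3
      + (d1 i * a4 i / 24 + d2 i / 2 * (a1 i * a3 i / 3 + a2 i ^ 2 / 4)
         + d3 i / 4 * a1 i ^ 2 * a2 i + d4 i / 24 * a1 i ^ 4) * x i ^ 4)\<bar>
     \<le> (\<bar>B2\<bar> * BP ^ 5 + BE) * \<bar>x i\<bar> ^ 5" (is "\<bar>F i - ?T\<bar> \<le> _") if i: "i \<in> S" for i
  proof -
    let ?G = "d0 i + d1 i * w i + d2 i / 2 * w i ^ 2 + d3 i / 6 * w i ^ 3 + d4 i / 24 * w i ^ 4"
    have w1: "w i = a1 i * x i + a2 i / 2 * x i ^ 2 + a3 i / 6 * x i ^ 3 + a4 i / 24 * x i ^ 4 + x i ^ 5 * \<rho> i"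
      unfolding wx[OF i] P1_def P2_def P3_def P4_def
      by (simp add: algebra_simps power_numeral_reduce)
    have w2: "w i ^ 2 = a1 i ^ 2 * x i ^ 2 + a1 i * a2 i * x i ^ 3
        + (a1 i * a3 i / 3 + a2 i ^ 2 / 4) * x i ^ 4 + x i ^ 5 * E2 i"
    proof -
      have "w i ^ 2 = x i ^ 2 * (a1 i + x i * (a2 i / 2 + x i * P3 i)) ^ 2"
        unfolding wx[OF i] P1_def P2_def by (simp add: power_mult_distrib)
      also have "\<dots> = a1 i ^ 2 * x i ^ 2 + a1 i * a2 i * x i ^ 3
        + (2 * a1 i * P3 i + a2 i ^ 2 / 4) * x i ^ 4 + x i ^ 5 * (a2 i * P3 i + x i * P3 i ^ 2)"
        by (simp add: algebra_simps power_numeral_reduce)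
      also have "2 * a1 i * P3 i = a1 i * a3 i / 3 + 2 * a1 i * x i * P4 i"
        by (simp add: P3_def algebra_simps)
      finally show ?thesis
        by (simp add: E2_def algebra_simps power_numeral_reduce)
    qed
    have w3: "w i ^ 3 = a1 i ^ 3 * x i ^ 3 + 3 / 2 * a1 i ^ 2 * a2 i * x i ^ 4 + x i ^ 5 * E3 i"
    proof -
      have "w i ^ 3 = x i ^ 3 * (a1 i + x i * P2 i) ^ 3"
        unfolding wx[OF i] P1_def by (simp add: power_mult_distrib)
      also have "\<dots> = a1 i ^ 3 * x i ^ 3 + 3 * a1 i ^ 2 * P2 i * x i ^ 4
          + x i ^ 5 * (3 * a1 i * P2 i ^ 2 + x i * P2 i ^ 3)"
        by (simp add: algebra_simps power_numeral_reduce)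
      also have "3 * a1 i ^ 2 * P2 i = 3 / 2 * a1 i ^ 2 * a2 i + 3 * a1 i ^ 2 * x i * P3 i"
        by (simp add: P2_def algebra_simps)
      finally show ?thesis
        by (simp add: E3_def algebra_simps power_numeral_reduce)
    qed
    have w4: "w i ^ 4 = a1 i ^ 4 * x i ^ 4 + x i ^ 5 * E4 i"
    proof -
      have "w i ^ 4 = x i ^ 4 * (a1 i + x i * P2 i) ^ 4"
        unfolding wx[OF i] P1_def by (simp add: power_mult_distrib)
      also have "\<dots> = a1 i ^ 4 * x i ^ 4 + x i ^ 5 * E4 i"
        unfolding E4_def by (simp add: algebra_simps power_numeral_reduce)
      finally show ?thesis .
    qed
    \<comment> \<open>By construction the truncated powers of \<open>w\<close> reproduce the claimed coefficients.\<close>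
    have G: "?G - ?T = x i ^ 5 * E i"
      unfolding w2 w3 w4 unfolding w1 E_def by (simp add: algebra_simps)
    have "\<bar>F i - ?G\<bar> \<le> \<bar>B2\<bar> * \<bar>w i\<bar> ^ 5"
      using F[OF i] by (rule order_trans) (auto intro!: mult_right_mono)
    also have "\<bar>w i\<bar> ^ 5 \<le> BP ^ 5 * \<bar>x i\<bar> ^ 5"
      using BP[OF i] unfolding wx[OF i] abs_mult power_mult_distrib
      by (subst mult.commute) (intro mult_right_mono power_mono, auto)
    finally have "\<bar>F i - ?G\<bar> \<le> \<bar>B2\<bar> * BP ^ 5 * \<bar>x i\<bar> ^ 5"
      by (simp add: mult_left_mono mult.assoc)
    moreover have "\<bar>?G - ?T\<bar> \<le> BE * \<bar>x i\<bar> ^ 5"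
      unfolding G abs_mult power_abs using BE[OF i] by (subst mult.commute) (intro mult_right_mono, auto)
    ultimately show ?thesis
      unfolding distrib_right by (rule abs_diff_triangle)
  qed
  then show ?thesis by (intro exI[of _ "\<bar>B2\<bar> * BP ^ 5 + BE"]) blast
qed

section \<open>Integrals of the ray derivatives\<close>

lemma lborel_integral_affine:
  fixes f :: "'a::euclidean_space \<Rightarrow> real"
  assumes "f \<in> borel_measurable borel" "c \<noteq> 0"
  shows "(LINT x|lborel. f x) = \<bar>c\<bar> ^ DIM('a) * (LINT x|lborel. f (t + c *\<^sub>R x))"
  using assms by (subst lborel_affine[of c t]) (auto simp: integral_density integral_distr)

lemma integral_odd_eq_0:
  fixes f :: "'a::euclidean_space \<Rightarrow> real"
  assumes "\<And>x. f (- x) = - f x"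
  shows "(LINT x|lborel. f x) = 0"
proof (cases "f \<in> borel_measurable borel")
  case True
  then show ?thesis
    using lborel_integral_affine[of f "-1" 0] assms by simp
next
  case False
  then have "\<not> integrable lborel f" by (auto dest: borel_measurable_integrable)
  then show ?thesis by (rule not_integrable_integral_eq)
qed

lemma continuous_on_bump_fst:
  fixes v :: real
  assumes "a > real (k + j)"
  shows "continuous_on UNIV (\<lambda>u :: 'a::euclidean_space. bump a k m j u v)"
proof -
  have "continuous_on UNIV (\<lambda>u :: 'a. (\<lambda>(u, v). bump a k m j u v) (u, v))"
    by (rule continuous_on_compose2[OF continuous_on_bump[OF assms]])
      (auto intro!: continuous_on_Pair continuous_on_id continuous_on_const)
  then show ?thesis by simp
qed

lemma bump_eq_0_norm:
  assumes "w > 0" "norm u > 1 / w" "v \<ge> w"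
  shows "bump a k m j u v = 0"
proof (rule bump_eq_0)
  have "1 \<le> v * norm u"
  proof -
    have "1 < w * norm u" using assms by (simp add: divide_less_eq mult.commute)
    also have "\<dots> \<le> v * norm u" using assms by (intro mult_right_mono) auto
    finally show ?thesis by simp
  qed
  then have "1 \<le> (v * norm u)\<^sup>2" by (rule one_le_power)
  then show "1 \<le> v\<^sup>2 * (u \<bullet> u)" by (simp add: power_mult_distrib dot_square_norm)
qed

lemma integrable_bump_times:
  assumes "a > real k" "continuous_on UNIV p"
  shows "integrable lborel (\<lambda>u :: 'a::euclidean_space. bump a k m 0 u 1 * p u)"
proof (rule integrable_continuous_compact_support)
  show "continuous_on UNIV (\<lambda>u. bump a k m 0 u 1 * p u)"
    using assms by (intro continuous_intros continuous_on_bump_fst) auto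
  show "bump a k m 0 u 1 * p u = 0" if "norm u > 1" for u
    using bump_eq_0_norm[of 1 u 1] that by simp
qed

text \<open>The substitution \<open>u \<mapsto> v u\<close> produces \<open>v\<^sup>d\<close> from the Lebesgue measure and \<open>v\<^sup>r\<close> from \<open>p\<close>, which is exactly
  the power of \<open>v\<close> in front of the kernel.\<close>

lemma integral_bump_homogeneous_const:
  fixes p :: "'a::euclidean_space \<Rightarrow> real"
  assumes "a > 0" "continuous_on UNIV p" "\<And>c u. p (c *\<^sub>R u) = c ^ r * p u" "v > 0"
  shows "(LINT u|lborel. bump a 0 (DIM('a) + r) 0 u v * p u) = (LINT u|lborel. bump a 0 (DIM('a) + r) 0 u 1 * p u)"
proof -
  let ?f = "\<lambda>u. bump a 0 (DIM('a) + r) 0 u 1 * p u"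
  have "continuous_on UNIV ?f"
    using assms by (intro continuous_intros continuous_on_bump_fst) auto
  then have "(LINT u|lborel. ?f u) = v ^ DIM('a) * (LINT u|lborel. ?f (0 + v *\<^sub>R u))"
    using lborel_integral_affine[OF borel_measurable_continuous_onI[of ?f], of v 0] assms(4) by simp
  also have "\<dots> = (LINT u|lborel. v ^ DIM('a) * ?f (0 + v *\<^sub>R u))"
    by simp
  also have "\<dots> = (LINT u|lborel. bump a 0 (DIM('a) + r) 0 u v * p u)"
    by (intro Bochner_Integration.integral_cong)
      (auto simp: assms(3) power_add power2_eq_square mult_ac)
  finally show ?thesis ..
qed

text \<open>The \<open>k\<close>-th derivative of a constant. Instead of differentiating under the integral, the uniform
  Taylor expansion of the integrand is integrated: by induction only the \<open>k\<close>-th term is left, it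
  equals a remainder \<open>O(s\<^sup>k\<^sup>+\<^sup>1)\<close>, and letting \<open>s\<close> tend to \<open>0\<close> forces it to vanish.\<close>

lemma integral_bump_deriv_homogeneous:
  fixes p :: "'a::euclidean_space \<Rightarrow> real"
  assumes "a > real k + 1" "continuous_on UNIV p" "\<And>c u. p (c *\<^sub>R u) = c ^ r * p u" "k \<ge> 1"
  shows "(LINT u|lborel. bump a k (DIM('a) + r) 0 u 1 * p u) = 0"
  using assms(1,4)
proof (induction k rule: less_induct)
  case (less k)
  let ?m = "DIM('a) + r"
  let ?E = "\<lambda>i. LINT u|lborel. bump a i ?m 0 u 1 * p u"
  obtain B where B0: "B \<ge> 0" and B: "\<And>u :: 'a. \<And>v. norm u \<le> 2 \<Longrightarrow> \<bar>v - 1\<bar> \<le> 1/2 \<Longrightarrow>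
     \<bar>bump a 0 ?m 0 u v - (\<Sum>i<Suc k. bump a i ?m 0 u 1 / fact i * (v - 1) ^ i)\<bar> \<le> B * \<bar>v - 1\<bar> ^ Suc k"
    using bump_taylor[of "Suc k" a 2 "1/2" ?m] less.prems by auto
  define I where "I = (LINT u|lborel. indicator (cball (0::'a) 2) u * \<bar>p u\<bar>)"
  have pint: "integrable lborel (\<lambda>u. indicator (cball (0::'a) 2) u * \<bar>p u\<bar>)"
    using borel_integrable_compact[of "cball 0 2" "\<lambda>u. \<bar>p u\<bar>"] assms(2)
    by (auto intro!: continuous_intros intro: continuous_on_subset)
  have key: "\<bar>?E k / fact k\<bar> \<le> B * I * s" if s: "0 < s" "s \<le> 1/2" for s
  proof -
    have i1: "integrable lborel (\<lambda>u. bump a 0 ?m 0 u (1 + s) * p u)"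
    proof (rule integrable_continuous_compact_support)
      show "continuous_on UNIV (\<lambda>u. bump a 0 ?m 0 u (1 + s) * p u)"
        using assms(2) less.prems by (intro continuous_intros continuous_on_bump_fst) auto
      show "bump a 0 ?m 0 u (1 + s) * p u = 0" if "norm u > 1" for u
        using bump_eq_0_norm[of 1 u "1 + s"] that s by simp
    qed
    have i2: "integrable lborel (\<lambda>u. bump a i ?m 0 u 1 / fact i * s ^ i * p u)" if "i < Suc k" for i
    proof -
      have "integrable lborel (\<lambda>u. bump a i ?m 0 u 1 * p u)"
        using that less.prems by (intro integrable_bump_times assms(2)) auto
      then have "integrable lborel (\<lambda>u. (s ^ i / fact i) * (bump a i ?m 0 u 1 * p u))"
        by (rule integrable_mult_right)
      then show ?thesis by (simp add: mult_ac)
    qed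
    have "(LINT u|lborel. bump a 0 ?m 0 u (1 + s) * p u - (\<Sum>i<Suc k. bump a i ?m 0 u 1 / fact i * s ^ i * p u))
        = ?E 0 - (\<Sum>i<Suc k. ?E i / fact i * s ^ i)"
    proof -
      have "(LINT u|lborel. bump a i ?m 0 u 1 / fact i * s ^ i * p u) = ?E i / fact i * s ^ i" for i
      proof -
        have "(LINT u|lborel. bump a i ?m 0 u 1 / fact i * s ^ i * p u)
          = (LINT u|lborel. (s ^ i / fact i) * (bump a i ?m 0 u 1 * p u))"
          by (simp add: mult_ac)
        also have "\<dots> = (s ^ i / fact i) * ?E i"
          by (rule integral_mult_right_zero)
        finally show ?thesis by (simp add: mult_ac del: bump.simps)
      qed
      moreover have "(LINT u|lborel. bump a 0 ?m 0 u (1 + s) * p u) = ?E 0"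
        using assms(2,3) less.prems s by (intro integral_bump_homogeneous_const) auto
      moreover have "(LINT u|lborel. (\<Sum>i<Suc k. bump a i ?m 0 u 1 / fact i * s ^ i * p u))
          = (\<Sum>i<Suc k. LINT u|lborel. bump a i ?m 0 u 1 / fact i * s ^ i * p u)"
        by (rule Bochner_Integration.integral_sum) (use i2 in blast)
      moreover have "integrable lborel (\<lambda>u. \<Sum>i<Suc k. bump a i ?m 0 u 1 / fact i * s ^ i * p u)"
        by (rule Bochner_Integration.integrable_sum) (use i2 in blast)
      ultimately show ?thesis
        using Bochner_Integration.integral_diff[OF i1] by (simp only:)
    qed
    also have "(\<Sum>i<Suc k. ?E i / fact i * s ^ i) = (\<Sum>i\<in>{0, k}. ?E i / fact i * s ^ i)"
      using less by (intro sum.mono_neutral_right) (auto simp del: bump.simps)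
    also have "?E 0 - \<dots> = - (?E k / fact k * s ^ k)"
      using less.prems by (simp del: bump.simps)
    finally have eq: "\<bar>?E k / fact k * s ^ k\<bar>
      = \<bar>LINT u|lborel. bump a 0 ?m 0 u (1 + s) * p u - (\<Sum>i<Suc k. bump a i ?m 0 u 1 / fact i * s ^ i * p u)\<bar>"
      by (simp del: bump.simps)
    also have "\<dots> \<le> (LINT u|lborel. \<bar>bump a 0 ?m 0 u (1 + s) * p u - (\<Sum>i<Suc k. bump a i ?m 0 u 1 / fact i * s ^ i * p u)\<bar>)"
      by (rule integral_abs_bound)
    also have "\<dots> \<le> (LINT u|lborel. (B * s ^ Suc k) * (indicator (cball 0 2) u * \<bar>p u\<bar>))"
    proof (rule integral_mono)
      show "integrable lborel (\<lambda>u. \<bar>bump a 0 ?m 0 u (1 + s) * p u - (\<Sum>i<Suc k. bump a i ?m 0 u 1 / fact i * s ^ i * p u)\<bar>)"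
        using i1 i2 by (intro integrable_abs Bochner_Integration.integrable_diff Bochner_Integration.integrable_sum) auto
      show "integrable lborel (\<lambda>u. (B * s ^ Suc k) * (indicator (cball 0 2) u * \<bar>p u\<bar>))"
        using pint by (rule integrable_mult_right)
      fix u :: 'a
      show "\<bar>bump a 0 ?m 0 u (1 + s) * p u - (\<Sum>i<Suc k. bump a i ?m 0 u 1 / fact i * s ^ i * p u)\<bar>
          \<le> (B * s ^ Suc k) * (indicator (cball 0 2) u * \<bar>p u\<bar>)"
      proof (cases "norm u \<le> 2")
        case True
        have "\<bar>bump a 0 ?m 0 u (1 + s) - (\<Sum>i<Suc k. bump a i ?m 0 u 1 / fact i * s ^ i)\<bar> * \<bar>p u\<bar>
           \<le> (B * s ^ Suc k) * \<bar>p u\<bar>"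
          using B[OF True, of "1 + s"] s by (intro mult_right_mono) (auto simp del: bump.simps)
        then show ?thesis using True
          by (simp add: left_diff_distrib sum_distrib_right distrib_right flip: abs_mult del: bump.simps)
      next
        case False
        then have "bump a i ?m 0 u (1 + s) = 0" "bump a i ?m 0 u 1 = 0" for i
          using bump_eq_0_norm[of 1 u] s by auto
        with False show ?thesis by (simp del: bump.simps)
      qed
    qed
    also have "\<dots> = (B * I * s) * s ^ k"
      by (simp add: I_def)
    finally have "\<bar>?E k / fact k\<bar> * s ^ k \<le> (B * I * s) * s ^ k"
      using s by (simp add: abs_mult del: bump.simps)
    then show ?thesis by (rule mult_right_le_imp_le) (use s in simp)
  qed
  have "((\<lambda>s. B * I * s) \<longlongrightarrow> B * I * 0) (at_right 0)"
    by (intro tendsto_intros)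
  moreover have "\<forall>\<^sub>F s in at_right 0. \<bar>?E k / fact k\<bar> \<le> B * I * s"
    unfolding eventually_at_right_field by (intro exI[of _ "1/2"]) (use key in auto)
  ultimately have "\<bar>?E k / fact k\<bar> \<le> B * I * 0"
    by (intro tendsto_lowerbound[of "\<lambda>s. B * I * s"]) auto
  then have "?E k / fact k = 0" by (simp only: mult_zero_right abs_le_zero_iff)
  then show ?case by (simp del: bump.simps)
qed

section \<open>Moments of sums over independent point processes\<close>

lemma space_config_space: "space config_space = locally_finite_configs"
  unfolding config_space_def by (rule space_measure_of) auto

lemma locally_finite_configsD:
  "\<phi> \<in> locally_finite_configs \<Longrightarrow> bounded B \<Longrightarrow> finite (\<phi> \<inter> B)"
  by (auto simp: locally_finite_configs_def)

lemma measurable_card_Int: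
  assumes "B \<in> sets borel" "bounded B"
  shows "(\<lambda>\<phi>. card (\<phi> \<inter> B)) \<in> measurable config_space (count_space UNIV)"
proof -
  have "(\<lambda>\<phi>. card (\<phi> \<inter> B)) -` {k} \<inter> space config_space \<in> sets config_space" for k
  proof -
    have "{\<phi> \<in> locally_finite_configs. card (\<phi> \<inter> B) = k} \<in> sets config_space"
      unfolding config_space_def using assms by (intro in_measure_of) auto
    also have "{\<phi> \<in> locally_finite_configs. card (\<phi> \<inter> B) = k}
        = (\<lambda>\<phi>. card (\<phi> \<inter> B)) -` {k} \<inter> space config_space"
      by (auto simp: space_config_space)
    finally show ?thesis .
  qed
  then show ?thesis
    by (subst measurable_count_space_eq2_countable) auto
qed

text \<open>For indicators the sum is a count, and these are measurable by definition of the
  sigma-algebra; boundedness of \<open>W\<close> makes \<open>\<phi> \<inter> W\<close> finite, so that the sum really is that count.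
  Linear combinations and monotone limits give the rest.\<close>

lemma measurable_sum_over_config:
  fixes f :: "real ^ 'd \<Rightarrow> ennreal"
  assumes f: "f \<in> borel_measurable borel" and W: "W \<in> sets borel" "bounded W"
  shows "(\<lambda>\<phi>. \<Sum>y\<in>\<phi> \<inter> W. f y) \<in> borel_measurable config_space"
  using f
proof (induction rule: borel_measurable_induct)
  case (cong f g)
  then show ?case by simp
next
  case (set A)
  have "(\<lambda>\<phi>. of_nat (card (\<phi> \<inter> (W \<inter> A))) :: ennreal) \<in> borel_measurable config_space"
    using set W by (intro measurable_compose[OF measurable_card_Int]) (auto intro: bounded_subset)
  moreover have "(\<Sum>y\<in>\<phi> \<inter> W. indicator A y :: ennreal) = of_nat (card (\<phi> \<inter> (W \<inter> A)))"
    if "\<phi> \<in> space config_space" for \<phi>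
    using locally_finite_configsD[of \<phi> W] that W
    by (simp add: space_config_space indicator_def sum.If_cases Int_assoc Collect_mem_eq)
  ultimately show ?case
    by (subst measurable_cong) auto
next
  case (mult u c)
  then show ?case by (simp add: sum_distrib_left[symmetric])
next
  case (add u v)
  then show ?case by (simp add: sum.distrib)
next
  case (seq U)
  have "(\<lambda>\<phi>. SUP i. \<Sum>y\<in>\<phi> \<inter> W. U i y) \<in> borel_measurable config_space"
    using seq by (intro borel_measurable_SUP) auto
  moreover have "(\<Sum>y\<in>\<phi> \<inter> W. (SUP i. U i) y) = (SUP i. \<Sum>y\<in>\<phi> \<inter> W. U i y)" for \<phi>
    using \<open>incseq U\<close> by (subst ennreal_SUP_sum) (auto simp: incseq_def le_fun_def image_comp)
  ultimately show ?case by (simp only:)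
qed

lemma measurable_real_sum_over_config:
  fixes K :: "real ^ 'd \<Rightarrow> real"
  assumes "K \<in> borel_measurable borel" "\<And>y. 0 \<le> K y" "W \<in> sets borel" "bounded W"
  shows "(\<lambda>\<phi>. \<Sum>y\<in>\<phi> \<inter> W. K y) \<in> borel_measurable config_space"
proof -
  have "(\<lambda>\<phi>. enn2real (\<Sum>y\<in>\<phi> \<inter> W. ennreal (K y))) \<in> borel_measurable config_space"
    using assms by (intro borel_measurable_enn2real measurable_sum_over_config) auto
  also have "(\<lambda>\<phi>. enn2real (\<Sum>y\<in>\<phi> \<inter> W. ennreal (K y))) = (\<lambda>\<phi>. \<Sum>y\<in>\<phi> \<inter> W. K y)"
    using assms(2) by (simp add: sum_ennreal sum_nonneg)
  finally show ?thesis .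
qed

lemma integrable_bounded_on_window:
  fixes f :: "'a::euclidean_space \<Rightarrow> real"
  assumes "f \<in> borel_measurable borel" "bounded W" "\<And>x. x \<notin> W \<Longrightarrow> f x = 0" "\<And>x. x \<in> W \<Longrightarrow> \<bar>f x\<bar> \<le> b"
  shows "integrable lborel f"
proof -
  obtain R where R: "W \<subseteq> cball 0 R" using bounded_subset_ballD[OF assms(2), of 0] ball_subset_cball by blast
  have "integrable lborel (\<lambda>x. indicator (cball 0 R) x *\<^sub>R max 0 b)"
    by (rule borel_integrable_compact) auto
  then show ?thesis
  proof (rule Bochner_Integration.integrable_bound)
    show "AE x in lborel. norm (f x) \<le> norm (indicator (cball 0 R) x *\<^sub>R max 0 b)"
    proof (intro AE_I2)
      fix x
      show "norm (f x) \<le> norm (indicator (cball 0 R) x *\<^sub>R max 0 b)"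
      proof (cases "x \<in> W")
        case True
        then have "x \<in> cball 0 R" using R by auto
        then show ?thesis using assms(4)[OF True] by simp
      qed (simp add: assms(3))
    qed
  qed (use assms(1) in simp)
qed

lemma sum_square_eq_diagonal_plus_pairs:
  fixes K :: "'a \<Rightarrow> real"
  assumes "finite A"
  shows "(\<Sum>y\<in>A. K y)\<^sup>2 = (\<Sum>y\<in>A. (K y)\<^sup>2) + (\<Sum>p\<in>distinct_pairs A. K (fst p) * K (snd p))"
proof -
  have "(\<Sum>y\<in>A. K y)\<^sup>2 = (\<Sum>p\<in>A \<times> A. K (fst p) * K (snd p))"
    by (simp add: power2_eq_square sum_product sum.cartesian_product case_prod_unfold)
  also have "A \<times> A = (\<lambda>y. (y, y)) ` A \<union> distinct_pairs A"
    by (auto simp: distinct_pairs_def)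
  also have "(\<Sum>p\<in>\<dots>. K (fst p) * K (snd p))
      = (\<Sum>p\<in>(\<lambda>y. (y, y)) ` A. K (fst p) * K (snd p)) + (\<Sum>p\<in>distinct_pairs A. K (fst p) * K (snd p))"
    using assms by (intro sum.union_disjoint finite_subset[of "distinct_pairs A" "A \<times> A"])
      (auto simp: distinct_pairs_def)
  also have "(\<Sum>p\<in>(\<lambda>y. (y, y)) ` A. K (fst p) * K (snd p)) = (\<Sum>y\<in>A. (K y)\<^sup>2)"
    by (subst sum.reindex) (auto simp: inj_on_def power2_eq_square)
  finally show ?thesis .
qed

text \<open>The hypothesis on \<open>r\<close> expresses a pair correlation function bounded by \<open>C\<close>, without
  dividing by \<open>l\<close>.\<close>

locale observed_point_process = prob_space M for M :: "'w measure" +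
  fixes X :: "'w \<Rightarrow> (real ^ 'd) set" and W :: "(real ^ 'd) set"
    and l :: "real ^ 'd \<Rightarrow> real" and r :: "real ^ 'd \<Rightarrow> real ^ 'd \<Rightarrow> real" and L C :: real
  assumes W: "open W" "bounded W"
    and X: "X \<in> measurable M config_space"
    and intensity: "intensity_function M X W l"
    and product_density: "second_order_product_density M X W r"
    and l_le: "\<And>u. u \<in> W \<Longrightarrow> l u \<le> L"
    and C: "C \<ge> 0" and r_le: "\<And>u v. u \<in> W \<Longrightarrow> v \<in> W \<Longrightarrow> r u v \<le> C * (l u * l v)"
begin

lemma W_borel [measurable]: "W \<in> sets borel"
  using W by simp

lemma l_nonneg: "u \<in> W \<Longrightarrow> 0 \<le> l u"
  using intensity by (auto simp: intensity_function_def)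

lemma l_measurable: "(\<lambda>u. indicator W u * l u) \<in> borel_measurable borel"
  using intensity W_borel
  by (simp add: intensity_function_def borel_measurable_restrict_space_iff)

lemma integrable_intensity_times:
  assumes "K \<in> borel_measurable borel" "\<And>y. 0 \<le> K y" "\<And>y. K y \<le> b"
  shows "integrable lborel (\<lambda>u. indicator W u * (K u * l u))"
proof (rule integrable_bounded_on_window[OF _ W(2)])
  show "(\<lambda>u. indicator W u * (K u * l u)) \<in> borel_measurable borel"
    using borel_measurable_times[OF assms(1) l_measurable] by (simp add: mult_ac)
  show "\<bar>indicator W u * (K u * l u)\<bar> \<le> b * L" if "u \<in> W" for u
    using that assms(2,3)[of u] l_nonneg[of u] l_le[of u]
    by (auto simp: abs_mult intro!: mult_mono)
qed auto

lemma campbell_mean: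
  assumes "K \<in> borel_measurable borel" "\<And>y. 0 \<le> K y" "\<And>y. K y \<le> b"
  shows "has_bochner_integral M (\<lambda>\<omega>. \<Sum>y\<in>X \<omega> \<inter> W. K y) (LINT u:W|lborel. K u * l u)"
proof (rule has_bochner_integral_nn_integral)
  show "(\<lambda>\<omega>. \<Sum>y\<in>X \<omega> \<inter> W. K y) \<in> borel_measurable M"
    using measurable_compose[OF X measurable_real_sum_over_config[OF assms(1,2) W_borel W(2)]] .
  show "AE \<omega> in M. 0 \<le> (\<Sum>y\<in>X \<omega> \<inter> W. K y)"
    using assms(2) by (simp add: sum_nonneg)
  show "0 \<le> (LINT u:W|lborel. K u * l u)"
    unfolding set_lebesgue_integral_def using assms(2) l_nonneg
    by (intro Bochner_Integration.integral_nonneg) (auto simp: indicator_def)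
  have "(\<integral>\<^sup>+\<omega>. ennreal (\<Sum>y\<in>X \<omega> \<inter> W. K y) \<partial>M) = (\<integral>\<^sup>+\<omega>. (\<Sum>y\<in>X \<omega> \<inter> W. ennreal (K y)) \<partial>M)"
    using assms(2) by (simp add: sum_ennreal)
  also have "\<dots> = (\<integral>\<^sup>+u\<in>W. (ennreal (K u) * ennreal (l u)) \<partial>lborel)"
    using intensity assms(1) by (simp add: intensity_function_def)
  also have "\<dots> = (\<integral>\<^sup>+u. ennreal (indicator W u * (K u * l u)) \<partial>lborel)"
    using assms(2) l_nonneg by (intro nn_integral_cong) (auto simp: indicator_def ennreal_mult)
  also have "\<dots> = ennreal (LINT u|lborel. indicator W u * (K u * l u))"
    using assms(2) l_nonneg
    by (intro nn_integral_eq_integral integrable_intensity_times[OF assms]) (auto simp: indicator_def)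
  finally show "(\<integral>\<^sup>+\<omega>. ennreal (\<Sum>y\<in>X \<omega> \<inter> W. K y) \<partial>M) = ennreal (LINT u:W|lborel. K u * l u)"
    by (simp add: set_lebesgue_integral_def)
qed

text \<open>After bounding the product density by \<open>C l(u) l(v)\<close> the double integral factorises.\<close>

lemma pairs_moment_le:
  assumes K: "K \<in> borel_measurable borel" "\<And>y. 0 \<le> K y" "\<And>y. K y \<le> b"
  shows "(\<integral>\<^sup>+\<omega>. (\<Sum>p\<in>distinct_pairs (X \<omega> \<inter> W). ennreal (K (fst p) * K (snd p))) \<partial>M)
     \<le> ennreal (C * (LINT u:W|lborel. K u * l u)\<^sup>2)"
proof -
  let ?k = "\<lambda>u. ennreal (indicator W u * (K u * l u))"
  have km: "?k \<in> borel_measurable borel"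
    using integrable_intensity_times[OF K] by (simp add: borel_measurable_integrable)
  have kint: "(\<integral>\<^sup>+u. ?k u \<partial>lborel) = ennreal (LINT u:W|lborel. K u * l u)"
    unfolding set_lebesgue_integral_def using K(2) l_nonneg
    by (subst nn_integral_eq_integral[OF integrable_intensity_times[OF K]]) (auto simp: indicator_def)
  have I0: "0 \<le> (LINT u:W|lborel. K u * l u)"
    unfolding set_lebesgue_integral_def using K(2) l_nonneg
    by (intro Bochner_Integration.integral_nonneg) (auto simp: indicator_def)
  have "(\<lambda>p. ennreal (K (fst p) * K (snd p))) \<in> borel_measurable (borel :: ((real ^ 'd) \<times> (real ^ 'd)) measure)"
    using K(1) by (simp flip: borel_prod)
  then have "(\<integral>\<^sup>+\<omega>. (\<Sum>p\<in>distinct_pairs (X \<omega> \<inter> W). ennreal (K (fst p) * K (snd p))) \<partial>M)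
    = (\<integral>\<^sup>+p\<in>W \<times> W. (ennreal (K (fst p) * K (snd p)) * ennreal (r (fst p) (snd p))) \<partial>lborel)"
    using product_density by (simp add: second_order_product_density_def)
  also have "\<dots> \<le> (\<integral>\<^sup>+p. ennreal C * (?k (fst p) * ?k (snd p)) \<partial>lborel)"
  proof (rule nn_integral_mono)
    fix p :: "(real ^ 'd) \<times> (real ^ 'd)"
    show "ennreal (K (fst p) * K (snd p)) * ennreal (r (fst p) (snd p)) * indicator (W \<times> W) p
       \<le> ennreal C * (?k (fst p) * ?k (snd p))"
    proof (cases "p \<in> W \<times> W")
      case True
      then have W2: "fst p \<in> W" "snd p \<in> W" by auto
      have r0: "0 \<le> r (fst p) (snd p)"
        using product_density W2 by (auto simp: second_order_product_density_def)
      have "K (fst p) * K (snd p) * r (fst p) (snd p) \<le> K (fst p) * K (snd p) * (C * (l (fst p) * l (snd p)))"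
        using K(2) r_le[OF W2] by (intro mult_left_mono) auto
      then show ?thesis
        using W2 K(2) C r0 l_nonneg[OF W2(1)] l_nonneg[OF W2(2)] True
        by (simp add: ennreal_mult[symmetric] mult_ac)
    qed auto
  qed
  also have "\<dots> = (\<integral>\<^sup>+p. ennreal C * (?k (fst p) * ?k (snd p)) \<partial>(lborel \<Otimes>\<^sub>M lborel))"
    by (simp add: lborel_prod)
  also have "\<dots> = ennreal C * ((\<integral>\<^sup>+u. ?k u \<partial>lborel) * (\<integral>\<^sup>+u. ?k u \<partial>lborel))"
    using km by (subst lborel.nn_integral_fst[symmetric])
      (simp_all add: nn_integral_cmult nn_integral_multc mult.assoc)
  also have "\<dots> = ennreal (C * (LINT u:W|lborel. K u * l u)\<^sup>2)"
    unfolding kint using C I0 by (simp add: ennreal_mult[symmetric] power2_eq_square)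
  finally show ?thesis .
qed

text \<open>The square of the sum is the sum of squares, whose mean is the integral of \<open>K\<^sup>2 l\<close>, plus the sum over
  distinct pairs. The variance subtracts the squared mean, which also controls the mean
  of the pair sum.\<close>

lemma campbell_second_moment:
  assumes K: "K \<in> borel_measurable borel" "\<And>y. 0 \<le> K y" "\<And>y. K y \<le> b"
  shows "integrable M (\<lambda>\<omega>. (\<Sum>y\<in>X \<omega> \<inter> W. K y)\<^sup>2)"
    and "\<bar>variance (\<lambda>\<omega>. \<Sum>y\<in>X \<omega> \<inter> W. K y) - (LINT u:W|lborel. (K u)\<^sup>2 * l u)\<bar>
          \<le> (C + 1) * (LINT u:W|lborel. K u * l u)\<^sup>2"
proof -
  let ?S = "\<lambda>\<omega>. \<Sum>y\<in>X \<omega> \<inter> W. K y" and ?D = "\<lambda>\<omega>. \<Sum>y\<in>X \<omega> \<inter> W. (K y)\<^sup>2"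
  let ?P = "\<lambda>\<omega>. \<Sum>p\<in>distinct_pairs (X \<omega> \<inter> W). K (fst p) * K (snd p)"
  let ?I = "LINT u:W|lborel. K u * l u"
  have K2: "(\<lambda>y. (K y)\<^sup>2) \<in> borel_measurable borel" "\<And>y. 0 \<le> (K y)\<^sup>2" "\<And>y. (K y)\<^sup>2 \<le> b\<^sup>2"
    using K by (auto intro: power_mono)
  note S = campbell_mean[OF K] and D = campbell_mean[OF K2]
  \<comment> \<open>Measurability of the pair sum comes from the difference of the other two sums.\<close>
  have Pm: "?P \<in> borel_measurable M"
  proof -
    have "(\<lambda>\<omega>. (?S \<omega>)\<^sup>2 - ?D \<omega>) \<in> borel_measurable M"
      using S D by (intro borel_measurable_diff borel_measurable_power) (auto simp: has_bochner_integral_iff)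
    moreover have "(?S \<omega>)\<^sup>2 - ?D \<omega> = ?P \<omega>" if "\<omega> \<in> space M" for \<omega>
    proof -
      have "finite (X \<omega> \<inter> W)"
        using measurable_space[OF X that] W(2) by (simp add: space_config_space locally_finite_configsD)
      from sum_square_eq_diagonal_plus_pairs[OF this, of K] show ?thesis by simp
    qed
    ultimately show ?thesis by (subst measurable_cong[of _ _ "\<lambda>\<omega>. (?S \<omega>)\<^sup>2 - ?D \<omega>"]) auto
  qed
  have P0: "0 \<le> ?P \<omega>" for \<omega> using K(2) by (intro sum_nonneg) auto
  have Ple: "(\<integral>\<^sup>+\<omega>. ennreal (?P \<omega>) \<partial>M) \<le> ennreal (C * ?I\<^sup>2)"
    using pairs_moment_le[OF K] K(2) by (simp add: sum_ennreal)
  have Pint: "integrable M ?P"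
    using Pm P0 Ple by (intro integrableI_nonneg) (auto intro: le_less_trans)
  have EP: "0 \<le> expectation ?P" "expectation ?P \<le> C * ?I\<^sup>2"
    using Ple P0 C by (auto simp: nn_integral_eq_integral[OF Pint] intro!: Bochner_Integration.integral_nonneg)
  have S2: "has_bochner_integral M (\<lambda>\<omega>. (?S \<omega>)\<^sup>2) ((LINT u:W|lborel. (K u)\<^sup>2 * l u) + expectation ?P)"
  proof -
    have "has_bochner_integral M (\<lambda>\<omega>. ?D \<omega> + ?P \<omega>) ((LINT u:W|lborel. (K u)\<^sup>2 * l u) + expectation ?P)"
      using D Pint by (intro has_bochner_integral_add) (auto simp: has_bochner_integral_iff)
    moreover have "(?S \<omega>)\<^sup>2 = ?D \<omega> + ?P \<omega>" if "\<omega> \<in> space M" for \<omega>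
      using measurable_space[OF X that] W(2)
      by (intro sum_square_eq_diagonal_plus_pairs) (simp add: space_config_space locally_finite_configsD)
    ultimately show ?thesis
      by (subst has_bochner_integral_cong[of M M _ "\<lambda>\<omega>. ?D \<omega> + ?P \<omega>"]) auto
  qed
  then show "integrable M (\<lambda>\<omega>. (?S \<omega>)\<^sup>2)" by (simp add: has_bochner_integral_iff)
  have "variance ?S = (LINT u:W|lborel. (K u)\<^sup>2 * l u) + expectation ?P - ?I\<^sup>2"
    using S S2 by (subst variance_eq) (auto simp: has_bochner_integral_iff)
  then show "\<bar>variance ?S - (LINT u:W|lborel. (K u)\<^sup>2 * l u)\<bar> \<le> (C + 1) * ?I\<^sup>2"
    using EP by (simp add: algebra_simps abs_le_iff)
      (smt (verit) zero_le_power2 mult_nonneg_nonneg C)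
qed

end

lemma (in prob_space) variance_cmult:
  fixes Y :: "'a \<Rightarrow> real"
  shows "variance (\<lambda>\<omega>. c * Y \<omega>) = c\<^sup>2 * variance Y"
proof -
  have "(c * Y \<omega> - c * expectation Y)\<^sup>2 = c\<^sup>2 * (Y \<omega> - expectation Y)\<^sup>2" for \<omega>
    by (simp add: power_mult_distrib flip: right_diff_distrib)
  then show ?thesis by simp
qed

lemma (in prob_space) variance_sum_indep:
  fixes X :: "'i \<Rightarrow> 'a \<Rightarrow> real"
  assumes "finite I" "indep_vars (\<lambda>_. borel) X I"
    and "\<And>i. i \<in> I \<Longrightarrow> integrable M (X i)" "\<And>i. i \<in> I \<Longrightarrow> integrable M (\<lambda>\<omega>. (X i \<omega>)\<^sup>2)"
  shows "integrable M (\<lambda>\<omega>. (\<Sum>i\<in>I. X i \<omega>)\<^sup>2)"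
    and "variance (\<lambda>\<omega>. \<Sum>i\<in>I. X i \<omega>) = (\<Sum>i\<in>I. variance (X i))"
proof -
  have "integrable M (\<lambda>\<omega>. (\<Sum>i\<in>I. X i \<omega>)\<^sup>2) \<and>
      variance (\<lambda>\<omega>. \<Sum>i\<in>I. X i \<omega>) = (\<Sum>i\<in>I. variance (X i))"
    using assms
  proof (induction I rule: finite_induct)
    case empty
    then show ?case by simp
  next
    case (insert i I)
    let ?S = "\<lambda>\<omega>. \<Sum>i\<in>I. X i \<omega>"
    have IH: "integrable M (\<lambda>\<omega>. (?S \<omega>)\<^sup>2)" "variance ?S = (\<Sum>i\<in>I. variance (X i))"
      using insert indep_vars_subset[OF insert.prems(1), of I] by auto
    have iS: "integrable M ?S" and iX: "integrable M (X i)" and iX2: "integrable M (\<lambda>\<omega>. (X i \<omega>)\<^sup>2)"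
      using insert by auto
    have ind: "indep_var borel (X i) borel ?S"
      using insert by (intro indep_vars_sum) auto
    have iXS: "integrable M (\<lambda>\<omega>. X i \<omega> * ?S \<omega>)"
      by (rule indep_var_integrable[OF ind iX iS])
    have EXS: "expectation (\<lambda>\<omega>. X i \<omega> * ?S \<omega>) = expectation (X i) * expectation ?S"
      by (rule indep_var_lebesgue_integral[OF ind iX iS])
    have sq: "(\<lambda>\<omega>. (X i \<omega> + ?S \<omega>)\<^sup>2) = (\<lambda>\<omega>. (X i \<omega>)\<^sup>2 + (?S \<omega>)\<^sup>2 + 2 * (X i \<omega> * ?S \<omega>))"
      by (simp add: power2_sum mult.assoc)
    have i2: "integrable M (\<lambda>\<omega>. (X i \<omega> + ?S \<omega>)\<^sup>2)"
      unfolding sq using IH(1) iX2 iXS by auto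
    have "variance (\<lambda>\<omega>. X i \<omega> + ?S \<omega>) = expectation (\<lambda>\<omega>. (X i \<omega> + ?S \<omega>)\<^sup>2) - (expectation (X i) + expectation ?S)\<^sup>2"
      using iX iS i2 by (subst variance_eq) auto
    also have "\<dots> = variance (X i) + variance ?S"
      unfolding sq using IH(1) iX2 iXS iX iS EXS
      by (subst (1 2) variance_eq) (auto simp: power2_sum)
    finally show ?case using IH i2 insert(1,2) by simp
  qed
  then show "integrable M (\<lambda>\<omega>. (\<Sum>i\<in>I. X i \<omega>)\<^sup>2)"
    "variance (\<lambda>\<omega>. \<Sum>i\<in>I. X i \<omega>) = (\<Sum>i\<in>I. variance (X i))" by auto
qed

lemma iid_point_processes_transfer:
  fixes F :: "(real ^ 'd) set \<Rightarrow> real"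
  assumes "iid_point_processes M \<Phi>" "i \<ge> 1" "F \<in> borel_measurable config_space"
  shows "integral\<^sup>L M (\<lambda>\<omega>. F (\<Phi> i \<omega>)) = integral\<^sup>L M (\<lambda>\<omega>. F (\<Phi> 1 \<omega>))"
    and "integrable M (\<lambda>\<omega>. F (\<Phi> i \<omega>)) \<longleftrightarrow> integrable M (\<lambda>\<omega>. F (\<Phi> 1 \<omega>))"
proof -
  have meas: "\<Phi> i \<in> measurable M config_space" "\<Phi> 1 \<in> measurable M config_space"
    and eq: "distr M config_space (\<Phi> i) = distr M config_space (\<Phi> 1)"
    using assms(1,2) order_refl[of "1 :: nat"] unfolding iid_point_processes_def point_process_def by blast+
  show "integral\<^sup>L M (\<lambda>\<omega>. F (\<Phi> i \<omega>)) = integral\<^sup>L M (\<lambda>\<omega>. F (\<Phi> 1 \<omega>))"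
    using integral_distr[OF meas(1) assms(3)] integral_distr[OF meas(2) assms(3)] eq by simp
  show "integrable M (\<lambda>\<omega>. F (\<Phi> i \<omega>)) \<longleftrightarrow> integrable M (\<lambda>\<omega>. F (\<Phi> 1 \<omega>))"
    using integrable_distr_eq[OF meas(1) assms(3)] integrable_distr_eq[OF meas(2) assms(3)] eq by simp
qed

text \<open>All summands have the law of the first one, and independence makes the variances add up, so the
  bound for a single process is divided by \<open>n\<close>.\<close>

lemma sample_mean_moments:
  fixes K :: "real ^ 'd \<Rightarrow> real"
  assumes iid: "iid_point_processes M \<Phi>"
    and obs: "observed_point_process M (\<Phi> 1) W l r L C"
    and K: "K \<in> borel_measurable borel" "\<And>y. 0 \<le> K y" "\<And>y. K y \<le> b" and n: "n \<ge> 1"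
  defines "T \<equiv> \<lambda>\<omega>. 1 / real n * (\<Sum>i = 1..n. \<Sum>y\<in>\<Phi> i \<omega> \<inter> W. K y)"
  shows "prob_space.expectation M T = (LINT u:W|lborel. K u * l u)"
    and "\<bar>prob_space.variance M T - (LINT u:W|lborel. (K u)\<^sup>2 * l u) / real n\<bar>
       \<le> (C + 1) * (LINT u:W|lborel. K u * l u)\<^sup>2 / real n"
proof -
  interpret observed_point_process M "\<Phi> 1" W l r L C by (rule obs)
  let ?F = "\<lambda>\<phi>. \<Sum>y\<in>\<phi> \<inter> W. K y"
  have Fm: "?F \<in> borel_measurable config_space"
    using K W by (intro measurable_real_sum_over_config) auto
  note E1 = campbell_mean[OF K] and V1 = campbell_second_moment[OF K]
  have E: "expectation (\<lambda>\<omega>. ?F (\<Phi> i \<omega>)) = (LINT u:W|lborel. K u * l u)"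
    and int: "integrable M (\<lambda>\<omega>. ?F (\<Phi> i \<omega>))" if "i \<ge> 1" for i
    using iid_point_processes_transfer[OF iid that Fm] E1 by (auto simp: has_bochner_integral_iff)
  have int2: "integrable M (\<lambda>\<omega>. (?F (\<Phi> i \<omega>))\<^sup>2)" if "i \<ge> 1" for i
    using iid_point_processes_transfer(2)[OF iid that, of "\<lambda>\<phi>. (?F \<phi>)\<^sup>2"] Fm V1(1) by simp
  have V: "variance (\<lambda>\<omega>. ?F (\<Phi> i \<omega>)) = variance (\<lambda>\<omega>. ?F (\<Phi> 1 \<omega>))" if "i \<ge> 1" for i
    using iid_point_processes_transfer(1)[OF iid that, of "\<lambda>\<phi>. (?F \<phi> - (LINT u:W|lborel. K u * l u))\<^sup>2"]
      E[OF that] E[of 1] Fm by simp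
  have "indep_vars (\<lambda>_. config_space) \<Phi> {1..}"
    using iid by (simp add: iid_point_processes_def)
  then have ind: "indep_vars (\<lambda>_. borel) (\<lambda>i \<omega>. ?F (\<Phi> i \<omega>)) {1..n}"
    by (intro indep_vars_compose2[OF indep_vars_subset[where J="{1..n}"]]) (auto intro: Fm)
  have "expectation T = 1 / real n * (\<Sum>i=1..n. (LINT u:W|lborel. K u * l u))"
    unfolding T_def using int E by simp
  then show "expectation T = (LINT u:W|lborel. K u * l u)" using n by simp
  have "variance T = (1 / real n)\<^sup>2 * variance (\<lambda>\<omega>. \<Sum>i=1..n. ?F (\<Phi> i \<omega>))"
    unfolding T_def by (rule variance_cmult)
  also have "variance (\<lambda>\<omega>. \<Sum>i=1..n. ?F (\<Phi> i \<omega>)) = (\<Sum>i=1..n. variance (\<lambda>\<omega>. ?F (\<Phi> i \<omega>)))"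
    using int int2 by (intro variance_sum_indep ind) auto
  also have "\<dots> = (\<Sum>i=1..n. variance (\<lambda>\<omega>. ?F (\<Phi> 1 \<omega>)))"
    by (rule sum.cong[OF refl V]) simp
  also have "\<dots> = real n * variance (\<lambda>\<omega>. ?F (\<Phi> 1 \<omega>))"
    by simp
  also have "(1 / real n)\<^sup>2 * (real n * v) = v / real n" for v
    using n by (simp add: power2_eq_square)
  finally have "variance T = variance (\<lambda>\<omega>. ?F (\<Phi> 1 \<omega>)) / real n" .
  then have "\<bar>variance T - (LINT u:W|lborel. (K u)\<^sup>2 * l u) / real n\<bar>
     = \<bar>variance (\<lambda>\<omega>. ?F (\<Phi> 1 \<omega>)) - (LINT u:W|lborel. (K u)\<^sup>2 * l u)\<bar> / real n"
    by (simp add: diff_divide_distrib[symmetric] abs_divide)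
  also have "\<dots> \<le> (C + 1) * (LINT u:W|lborel. K u * l u)\<^sup>2 / real n"
    using V1(2) by (intro divide_right_mono) auto
  finally show "\<bar>variance T - (LINT u:W|lborel. (K u)\<^sup>2 * l u) / real n\<bar>
       \<le> (C + 1) * (LINT u:W|lborel. K u * l u)\<^sup>2 / real n" .
qed

section \<open>Kernel integrals with a smooth bandwidth weight\<close>

lemma bump_0_le_power:
  assumes "a \<ge> 0" "v \<ge> 0"
  shows "0 \<le> bump a 0 m 0 u v" "bump a 0 m 0 u v \<le> v ^ m"
proof -
  have "max 0 (1 - v\<^sup>2 * (u \<bullet> u)) powr a \<le> 1"
    using assms by (intro powr_le1) auto
  then show "0 \<le> bump a 0 m 0 u v" "bump a 0 m 0 u v \<le> v ^ m"
    using assms by (auto intro!: mult_left_le)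
qed

lemma bump_0_square: "(bump a 0 m 0 u v)\<^sup>2 = bump (2 * a) 0 (2 * m) 0 u v"
  by (simp add: power_mult_distrib power_mult[symmetric] power2_eq_square[of "_ powr _"] powr_add[symmetric] mult.commute)

text \<open>Turns a pointwise expansion that is uniform on a ball into an expansion of the integral.\<close>

lemma integral_approx_on_cball:
  fixes F T :: "'a::euclidean_space \<Rightarrow> real"
  assumes F: "continuous_on (cball 0 R) F" and T: "integrable lborel T" "\<And>u. norm u > R \<Longrightarrow> T u = 0"
    and le: "\<And>u. norm u \<le> R \<Longrightarrow> \<bar>F u - T u\<bar> \<le> e"
  shows "\<bar>(LINT u|lborel. indicator (cball 0 R) u * F u) - (LINT u|lborel. T u)\<bar>
     \<le> e * measure lborel (cball (0 :: 'a) R)"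
proof -
  have iF: "integrable lborel (\<lambda>u. indicator (cball 0 R) u * F u)"
    using borel_integrable_compact[OF compact_cball F] by simp
  have "\<bar>(LINT u|lborel. indicator (cball 0 R) u * F u) - (LINT u|lborel. T u)\<bar>
      = \<bar>LINT u|lborel. indicator (cball 0 R) u * F u - T u\<bar>"
    using iF T(1) by simp
  also have "\<dots> \<le> (LINT u|lborel. \<bar>indicator (cball 0 R) u * F u - T u\<bar>)"
    by (rule integral_abs_bound)
  also have "\<dots> \<le> (LINT u|lborel. indicator (cball (0 :: 'a) R) u *\<^sub>R e)"
  proof (rule integral_mono)
    show "integrable lborel (\<lambda>u. \<bar>indicator (cball 0 R) u * F u - T u\<bar>)"
      using iF T(1) by (intro integrable_abs Bochner_Integration.integrable_diff)
    show "integrable lborel (\<lambda>u :: 'a. indicator (cball 0 R) u *\<^sub>R e)"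
      by (rule borel_integrable_compact) auto
    show "\<bar>indicator (cball 0 R) u * F u - T u\<bar> \<le> indicator (cball 0 R) u *\<^sub>R e" for u
      using le[of u] T(2)[of u] by (cases "norm u \<le> R") auto
  qed
  also have "\<dots> = e * measure lborel (cball (0 :: 'a) R)"
    by simp
  finally show ?thesis .
qed

text \<open>The properties of the Abramson weight that the expansions use.\<close>

locale smooth_weight =
  fixes W :: "(real ^ 'd) set" and x0 :: "real ^ 'd" and c :: "real ^ 'd \<Rightarrow> real"
    and c_low c_up r0 :: real
  assumes W: "open W" "cball x0 r0 \<subseteq> W" and r0: "r0 > 0" and c_x0: "c x0 = 1"
    and smooth: "times_continuously_differentiable_on 5 c W"
    and c_low: "c_low > 0" and c_bounds: "\<And>y. y \<in> W \<Longrightarrow> c_low \<le> c y \<and> c y \<le> c_up"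
begin

text \<open>Where the weight is at least \<open>c_low\<close>, the kernel at \<open>c u\<close> vanishes as soon as \<open>|u| > 1 / c_low\<close>.\<close>

definition R :: real where "R = 1 / c_low"

text \<open>Arguments \<open>t\<close> for which the segments \<open>x0 + t u\<close> with \<open>|u| \<le> R\<close> stay in the ball around \<open>x0\<close>
  inside the window; the bound \<open>1\<close> lets higher powers of \<open>t\<close> be absorbed into the remainder.\<close>

definition admissible :: "real \<Rightarrow> bool" where
  "admissible t \<longleftrightarrow> \<bar>t\<bar> * R \<le> r0 \<and> \<bar>t\<bar> \<le> 1"

definition kernel_integral :: "real \<Rightarrow> nat \<Rightarrow> real \<Rightarrow> real" where
  "kernel_integral a m t = (LINT u|lborel. indicator (cball 0 R) u * bump a 0 m 0 u (c (x0 + t *\<^sub>R u)))"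

lemma R_pos: "R > 0" using c_low by (simp add: R_def)

lemma c_continuous: "continuous_on W c"
  using smooth by (rule times_continuously_differentiable_on_imp_continuous_on)

lemma x0_in_W: "x0 \<in> W" using W r0 by auto

lemma R_ge_1: "R \<ge> 1"
  using c_bounds[OF x0_in_W] c_low c_x0 by (simp add: R_def)

lemma line_in_W:
  assumes "admissible t" "norm u \<le> R"
  shows "x0 + t *\<^sub>R u \<in> W"
proof -
  have "\<bar>t\<bar> * norm u \<le> \<bar>t\<bar> * R" using assms by (intro mult_left_mono) auto
  then have "x0 + t *\<^sub>R u \<in> cball x0 r0" using assms by (simp add: dist_norm admissible_def)
  then show ?thesis using W by blast
qed

lemma c_deviation: "y \<in> W \<Longrightarrow> \<bar>c y - 1\<bar> \<le> c_up + 1"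
  using c_bounds[of y] c_low c_bounds[OF x0_in_W] by auto

lemma measurable_weighted_bump:
  "(\<lambda>y. indicator W y * bump a 0 m 0 ((x0 - y) /\<^sub>R h) (c y)) \<in> borel_measurable borel"
proof -
  have [measurable]: "W \<in> sets borel" using W by simp
  have [measurable]: "(\<lambda>y. indicator W y *\<^sub>R c y) \<in> borel_measurable borel"
    using c_continuous by (intro borel_measurable_continuous_on_indicator) auto
  have "(\<lambda>y. indicator W y * bump a 0 m 0 ((x0 - y) /\<^sub>R h) (indicator W y *\<^sub>R c y)) \<in> borel_measurable borel"
    unfolding bump.simps by measurable
  also have "(\<lambda>y. indicator W y * bump a 0 m 0 ((x0 - y) /\<^sub>R h) (indicator W y *\<^sub>R c y))
    = (\<lambda>y. indicator W y * bump a 0 m 0 ((x0 - y) /\<^sub>R h) (c y))"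
    by (auto simp: indicator_def fun_eq_iff)
  finally show ?thesis .
qed

text \<open>Outside the ball of radius \<open>R\<close> the kernel vanishes at points of the window, and
  for admissible \<open>h\<close> all points \<open>x0 - h u\<close> with \<open>u\<close> in that ball lie in the window. So the indicator
  of the window can be traded for that of the ball.\<close>

lemma window_integral:
  assumes h: "h > 0" "admissible h" and "a > 0"
  shows "(LINT y|lborel. indicator W y * bump a 0 m 0 ((x0 - y) /\<^sub>R h) (c y))
     = h ^ CARD('d) * kernel_integral a m (- h)"
proof -
  have "(LINT y|lborel. indicator W y * bump a 0 m 0 ((x0 - y) /\<^sub>R h) (c y))
    = \<bar>- h\<bar> ^ DIM(real ^ 'd) * (LINT u|lborel. indicator W (x0 + (- h) *\<^sub>R u) *
        bump a 0 m 0 ((x0 - (x0 + (- h) *\<^sub>R u)) /\<^sub>R h) (c (x0 + (- h) *\<^sub>R u)))"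
    using h by (intro lborel_integral_affine measurable_weighted_bump) auto
  also have "(LINT u|lborel. indicator W (x0 + (- h) *\<^sub>R u) *
        bump a 0 m 0 ((x0 - (x0 + (- h) *\<^sub>R u)) /\<^sub>R h) (c (x0 + (- h) *\<^sub>R u)))
     = kernel_integral a m (- h)"
    unfolding kernel_integral_def
  proof (intro Bochner_Integration.integral_cong refl)
    fix u :: "real ^ 'd"
    have u: "(x0 - (x0 + (- h) *\<^sub>R u)) /\<^sub>R h = u" using h by simp
    show "indicator W (x0 + (- h) *\<^sub>R u) *
        bump a 0 m 0 ((x0 - (x0 + (- h) *\<^sub>R u)) /\<^sub>R h) (c (x0 + (- h) *\<^sub>R u))
      = indicator (cball 0 R) u * bump a 0 m 0 u (c (x0 + (- h) *\<^sub>R u))"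
    proof (cases "norm u \<le> R")
      case True
      then have "x0 + (- h) *\<^sub>R u \<in> W"
        using h by (intro line_in_W) (auto simp: admissible_def)
      then show ?thesis using True unfolding u by (simp del: bump.simps)
    next
      case False
      have "bump a 0 m 0 u (c (x0 + (- h) *\<^sub>R u)) = 0" if "x0 + (- h) *\<^sub>R u \<in> W"
        using False c_bounds[OF that] c_low unfolding R_def
        by (intro bump_eq_0_norm[of c_low]) auto
      then show ?thesis using False unfolding u by (auto simp: indicator_def simp del: bump.simps)
    qed
  qed
  finally show ?thesis using h by simp
qed

lemma continuous_on_shifted_bump:
  assumes "a > 0" "admissible t"
  shows "continuous_on (cball 0 R) (\<lambda>u. bump a 0 m 0 u (c (x0 + t *\<^sub>R u)))"
proof -
  have c: "continuous_on (cball 0 R) (\<lambda>u. c (x0 + t *\<^sub>R u))"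
    by (rule continuous_on_compose2[OF c_continuous]) (auto intro!: continuous_intros line_in_W assms)
  have bc: "continuous_on UNIV (\<lambda>(u :: real ^ 'd, v). bump a 0 m 0 u v)"
    using assms by (intro continuous_on_bump) auto
  have "continuous_on (cball 0 R) (\<lambda>u. (\<lambda>(u, v). bump a 0 m 0 u v) (u, c (x0 + t *\<^sub>R u)))"
    by (rule continuous_on_compose2[OF bc]) (auto intro!: continuous_on_Pair continuous_on_id c)
  then show ?thesis by simp
qed

text \<open>The bump is Lipschitz in \<open>v\<close> and the weight is Lipschitz along lines, uniformly in \<open>u\<close>.\<close>

lemma kernel_integral_order_1:
  assumes "a > 1"
  shows "\<exists>B. \<forall>t. admissible t \<longrightarrow>
    \<bar>kernel_integral a m t - (LINT u|lborel. bump a 0 m 0 (u :: real ^ 'd) 1)\<bar> \<le> B * \<bar>t\<bar>"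
proof -
  obtain B1 where B1: "B1 \<ge> 0" "\<And>(u :: real ^ 'd) v. norm u \<le> R \<Longrightarrow> \<bar>v - 1\<bar> \<le> c_up + 1 \<Longrightarrow>
      \<bar>bump a 0 m 0 u v - bump a 0 m 0 u 1\<bar> \<le> B1 * \<bar>v - 1\<bar>"
    using bump_taylor[of 1 a R "c_up + 1" m] assms by (auto simp del: bump.simps)
  have smooth1: "times_continuously_differentiable_on 1 c W"
    using smooth by (auto simp: times_continuously_differentiable_on_def)
  obtain B2 where B2: "B2 \<ge> 0" "\<And>u t. norm u \<le> R \<Longrightarrow> \<bar>t\<bar> * R \<le> r0 \<Longrightarrow> \<bar>c (x0 + t *\<^sub>R u) - 1\<bar> \<le> B2 * \<bar>t\<bar>"
    using line_taylor[OF W(1) smooth1 _ W(2), of R] R_pos c_x0 by (auto simp: diagonal_derivative_0)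
  have "\<bar>kernel_integral a m t - (LINT u|lborel. bump a 0 m 0 (u :: real ^ 'd) 1)\<bar>
      \<le> (B1 * B2 * measure lborel (cball (0 :: real ^ 'd) R)) * \<bar>t\<bar>" if t: "admissible t" for t
  proof -
    have "\<bar>kernel_integral a m t - (LINT u|lborel. bump a 0 m 0 (u :: real ^ 'd) 1)\<bar>
      \<le> (B1 * (B2 * \<bar>t\<bar>)) * measure lborel (cball (0 :: real ^ 'd) R)"
      unfolding kernel_integral_def
    proof (rule integral_approx_on_cball)
      show "continuous_on (cball 0 R) (\<lambda>u. bump a 0 m 0 u (c (x0 + t *\<^sub>R u)))"
        using assms t by (intro continuous_on_shifted_bump) auto
      show "integrable lborel (\<lambda>u :: real ^ 'd. bump a 0 m 0 u 1)"
        using integrable_bump_times[of 0 a "\<lambda>_. 1" m] assms by (auto simp del: bump.simps)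
      show "bump a 0 m 0 u 1 = 0" if "norm u > R" for u :: "real ^ 'd"
        using that R_ge_1 by (intro bump_eq_0_norm[of 1]) auto
      fix u :: "real ^ 'd" assume u: "norm u \<le> R"
      have "\<bar>bump a 0 m 0 u (c (x0 + t *\<^sub>R u)) - bump a 0 m 0 u 1\<bar> \<le> B1 * \<bar>c (x0 + t *\<^sub>R u) - 1\<bar>"
        using B1(2) u c_deviation line_in_W[OF t u] by blast
      also have "\<dots> \<le> B1 * (B2 * \<bar>t\<bar>)"
        using B1(1) B2(2)[OF u] t by (intro mult_left_mono) (auto simp: admissible_def)
      finally show "\<bar>bump a 0 m 0 u (c (x0 + t *\<^sub>R u)) - bump a 0 m 0 u 1\<bar> \<le> B1 * (B2 * \<bar>t\<bar>)" .
    qed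
    then show ?thesis by (simp add: mult_ac)
  qed
  then show ?thesis by blast
qed

abbreviation A :: "nat \<Rightarrow> real ^ 'd \<Rightarrow> real" where
  "A r u \<equiv> diagonal_derivative r c x0 u"

text \<open>The coefficient of \<open>t\<^sup>4\<close> in the composed expansion; for \<open>m = d + 2\<close> it is the bias integrand up to the
  normalising constant.\<close>

definition fourth_order_term :: "real \<Rightarrow> nat \<Rightarrow> real ^ 'd \<Rightarrow> real" where
  "fourth_order_term a m u =
     bump a 1 m 0 u 1 * A 4 u / 24
     + bump a 2 m 0 u 1 / 2 * (A 1 u * A 3 u / 3 + A 2 u ^ 2 / 4)
     + bump a 3 m 0 u 1 / 4 * A 1 u ^ 2 * A 2 u
     + bump a 4 m 0 u 1 / 24 * A 1 u ^ 4"

lemma continuous_on_A: "r \<le> 5 \<Longrightarrow> continuous_on UNIV (A r)"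
proof -
  assume "r \<le> 5"
  from continuous_on_diagonal_derivative[OF smooth this]
  have "continuous_on UNIV (\<lambda>u. (\<lambda>(x, u). diagonal_derivative r c x u) (x0, u))"
    by (rule continuous_on_compose2)
      (use x0_in_W in \<open>auto intro!: continuous_on_Pair continuous_on_id continuous_on_const\<close>)
  then show ?thesis by simp
qed

lemma A_0: "A 0 u = 1"
  by (simp add: diagonal_derivative_0 c_x0)

lemma A_minus: "A r (- u) = (- 1) ^ r * A r u"
  using diagonal_derivative_scaleR[of r c x0 "-1" u] by simp

lemma shifted_bump_expansion:
  assumes "a > 5"
  shows "\<exists>B. \<forall>u t. norm u \<le> R \<longrightarrow> admissible t \<longrightarrow>
    \<bar>bump a 0 m 0 u (c (x0 + t *\<^sub>R u)) - (bump a 0 m 0 u 1 + bump a 1 m 0 u 1 * A 1 u * t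
      + (bump a 1 m 0 u 1 * A 2 u / 2 + bump a 2 m 0 u 1 * A 1 u ^ 2 / 2) * t ^ 2
      + (bump a 1 m 0 u 1 * A 3 u / 6 + bump a 2 m 0 u 1 * A 1 u * A 2 u / 2
          + bump a 3 m 0 u 1 * A 1 u ^ 3 / 6) * t ^ 3
      + fourth_order_term a m u * t ^ 4)\<bar> \<le> B * \<bar>t\<bar> ^ 5"
proof -
  \<comment> \<open>Pairs of a direction and an argument index the expansion, so that its constant is uniform in both.\<close>
  define S where "S = {(u :: real ^ 'd, t). norm u \<le> R \<and> admissible t}"
  obtain B1 where B1: "\<And>(u :: real ^ 'd) v. norm u \<le> R \<Longrightarrow> \<bar>v - 1\<bar> \<le> c_up + 1 \<Longrightarrow>
      \<bar>bump a 0 m 0 u v - (\<Sum>k<5. bump a k m 0 u 1 / fact k * (v - 1) ^ k)\<bar> \<le> B1 * \<bar>v - 1\<bar> ^ 5"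
    using bump_taylor[of 5 a R "c_up + 1" m] assms by (auto simp del: bump.simps)
  obtain B2 where B2: "\<And>u t. norm u \<le> R \<Longrightarrow> \<bar>t\<bar> * R \<le> r0 \<Longrightarrow>
      \<bar>c (x0 + t *\<^sub>R u) - (\<Sum>k<5. A k u / fact k * t ^ k)\<bar> \<le> B2 * \<bar>t\<bar> ^ 5"
    using line_taylor[OF W(1) smooth _ W(2), of R] R_pos by auto
  have bA: "bounded ((\<lambda>i. A r (fst i)) ` S)" if "r \<le> 5" for r
  proof -
    have "bounded (A r ` cball 0 R)"
      using continuous_on_A[OF that]
      by (intro compact_imp_bounded compact_continuous_image compact_cball) (auto intro: continuous_on_subset)
    then show ?thesis by (rule bounded_subset) (auto simp: S_def)
  qed
  have bD: "bounded ((\<lambda>i. bump a k m 0 (fst i) 1) ` S)" if k: "k \<le> 4" for k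
  proof -
    obtain B where "\<forall>u :: real ^ 'd. \<forall>v. norm u \<le> R \<longrightarrow> \<bar>v\<bar> \<le> 1 \<longrightarrow> \<bar>bump a k m 0 u v\<bar> \<le> B"
      using bounded_bump[of k 0 a R 1 m] of_nat_mono[OF k, where 'a = real] assms by auto
    then show ?thesis by (auto simp: bounded_iff S_def simp del: bump.simps intro!: exI[of _ B])
  qed
  have bt: "bounded ((\<lambda>i. snd i) ` S)"
    by (auto simp: bounded_iff S_def admissible_def intro!: exI[of _ 1])
  have "\<exists>B. \<forall>i\<in>S.
    \<bar>bump a 0 m 0 (fst i) (c (x0 + snd i *\<^sub>R fst i)) - (bump a 0 m 0 (fst i) 1 + bump a 1 m 0 (fst i) 1 * A 1 (fst i) * snd i
      + (bump a 1 m 0 (fst i) 1 * A 2 (fst i) / 2 + bump a 2 m 0 (fst i) 1 * A 1 (fst i) ^ 2 / 2) * snd i ^ 2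
      + (bump a 1 m 0 (fst i) 1 * A 3 (fst i) / 6 + bump a 2 m 0 (fst i) 1 * A 1 (fst i) * A 2 (fst i) / 2
          + bump a 3 m 0 (fst i) 1 * A 1 (fst i) ^ 3 / 6) * snd i ^ 3
      + (bump a 1 m 0 (fst i) 1 * A 4 (fst i) / 24
         + bump a 2 m 0 (fst i) 1 / 2 * (A 1 (fst i) * A 3 (fst i) / 3 + A 2 (fst i) ^ 2 / 4)
         + bump a 3 m 0 (fst i) 1 / 4 * A 1 (fst i) ^ 2 * A 2 (fst i)
         + bump a 4 m 0 (fst i) 1 / 24 * A 1 (fst i) ^ 4) * snd i ^ 4)\<bar> \<le> B * \<bar>snd i\<bar> ^ 5"
  proof (rule taylor_compose_order_4[where w = "\<lambda>i. c (x0 + snd i *\<^sub>R fst i) - 1" and ?B1.0 = B2 and ?B2.0 = B1])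
    fix i assume "i \<in> S"
    then have u: "norm (fst i) \<le> R" and t: "admissible (snd i)" by (auto simp: S_def)
    show "\<bar>c (x0 + snd i *\<^sub>R fst i) - 1 - (A 1 (fst i) * snd i + A 2 (fst i) / 2 * snd i ^ 2
        + A 3 (fst i) / 6 * snd i ^ 3 + A 4 (fst i) / 24 * snd i ^ 4)\<bar> \<le> B2 * \<bar>snd i\<bar> ^ 5"
      using B2[OF u, of "snd i"] t A_0[of "fst i"]
      by (simp add: admissible_def eval_nat_numeral fact_numeral algebra_simps)
    show "\<bar>bump a 0 m 0 (fst i) (c (x0 + snd i *\<^sub>R fst i)) - (bump a 0 m 0 (fst i) 1
        + bump a 1 m 0 (fst i) 1 * (c (x0 + snd i *\<^sub>R fst i) - 1)
        + bump a 2 m 0 (fst i) 1 / 2 * (c (x0 + snd i *\<^sub>R fst i) - 1) ^ 2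
        + bump a 3 m 0 (fst i) 1 / 6 * (c (x0 + snd i *\<^sub>R fst i) - 1) ^ 3
        + bump a 4 m 0 (fst i) 1 / 24 * (c (x0 + snd i *\<^sub>R fst i) - 1) ^ 4)\<bar>
      \<le> B1 * \<bar>c (x0 + snd i *\<^sub>R fst i) - 1\<bar> ^ 5"
      using B1[OF u c_deviation[OF line_in_W[OF t u]]]
      by (simp add: lessThan_nat_numeral lessThan_Suc fact_numeral add_ac del: bump.simps)
  qed (intro bt bA bD; simp)+
  then show ?thesis
    by (auto simp: S_def fourth_order_term_def simp del: bump.simps)
qed

text \<open>The integrals of the first and third coefficients vanish by parity, that of the second because it is
  a combination of derivatives of the bump with homogeneous factors of degree two, the degree that
  \<open>m = d + 2\<close> is tuned to.\<close>

lemma kernel_integral_order_5: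
  assumes "a > 5"
  defines "m \<equiv> CARD('d) + 2"
  shows "\<exists>B. \<forall>t. admissible t \<longrightarrow>
    \<bar>kernel_integral a m t - ((LINT u|lborel. bump a 0 m 0 (u :: real ^ 'd) 1)
       + t ^ 4 * (LINT u|lborel. fourth_order_term a m u))\<bar> \<le> B * \<bar>t\<bar> ^ 5"
proof -
  obtain B where B: "\<And>u t. norm u \<le> R \<Longrightarrow> admissible t \<Longrightarrow>
    \<bar>bump a 0 m 0 u (c (x0 + t *\<^sub>R u)) - (bump a 0 m 0 u 1 + bump a 1 m 0 u 1 * A 1 u * t
      + (bump a 1 m 0 u 1 * A 2 u / 2 + bump a 2 m 0 u 1 * A 1 u ^ 2 / 2) * t ^ 2
      + (bump a 1 m 0 u 1 * A 3 u / 6 + bump a 2 m 0 u 1 * A 1 u * A 2 u / 2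
          + bump a 3 m 0 u 1 * A 1 u ^ 3 / 6) * t ^ 3
      + fourth_order_term a m u * t ^ 4)\<bar> \<le> B * \<bar>t\<bar> ^ 5"
    using shifted_bump_expansion[OF assms(1), of m] by blast
  define b1 where "b1 u = bump a 1 m 0 u 1 * A 1 u" for u
  define b2 where "b2 u = bump a 1 m 0 u 1 * (A 2 u / 2) + bump a 2 m 0 u 1 * (A 1 u ^ 2 / 2)" for u
  define b3 where "b3 u = bump a 1 m 0 u 1 * (A 3 u / 6) + bump a 2 m 0 u 1 * (A 1 u * A 2 u / 2)
          + bump a 3 m 0 u 1 * (A 1 u ^ 3 / 6)" for u
  have b4: "fourth_order_term a m u = bump a 1 m 0 u 1 * (A 4 u / 24)
     + bump a 2 m 0 u 1 * ((A 1 u * A 3 u / 3 + A 2 u ^ 2 / 4) / 2)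
     + bump a 3 m 0 u 1 * (A 1 u ^ 2 * A 2 u / 4)
     + bump a 4 m 0 u 1 * (A 1 u ^ 4 / 24)" for u
    by (simp add: fourth_order_term_def del: bump.simps)
  note int = integrable_bump_times Bochner_Integration.integrable_add continuous_on_mult
    continuous_on_divide continuous_on_power continuous_on_add continuous_on_const continuous_on_A
  have i0: "integrable lborel (\<lambda>u :: real ^ 'd. bump a 0 m 0 u 1)"
    using integrable_bump_times[of 0 a "\<lambda>_. 1" m] assms by (auto simp del: bump.simps)
  have i1: "integrable lborel b1"
    unfolding b1_def[abs_def] by (intro int) (use assms in auto)
  have i2: "integrable lborel b2"
    unfolding b2_def[abs_def] by (intro int) (use assms in auto)
  have i3: "integrable lborel b3"
    unfolding b3_def[abs_def] by (intro int) (use assms in auto)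
  have i4: "integrable lborel (fourth_order_term a m)"
    unfolding b4[abs_def] by (intro int) (use assms in auto)
  have z1: "(LINT u|lborel. b1 u) = 0" and z3: "(LINT u|lborel. b3 u) = 0"
    by (rule integral_odd_eq_0, simp add: b1_def b3_def bump_minus A_minus del: bump.simps)+
  have z2: "(LINT u|lborel. b2 u) = 0"
  proof -
    have "(LINT u|lborel. bump a 1 (DIM(real ^ 'd) + 2) 0 u 1 * (A 2 u / 2)) = 0"
      "(LINT u|lborel. bump a 2 (DIM(real ^ 'd) + 2) 0 u 1 * (A 1 u ^ 2 / 2)) = 0"
      by (rule integral_bump_deriv_homogeneous;
          use assms in \<open>auto intro!: int simp: diagonal_derivative_scaleR power_mult_distrib\<close>)+
    moreover have "integrable lborel (\<lambda>u. bump a 1 m 0 u 1 * (A 2 u / 2))"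
      "integrable lborel (\<lambda>u. bump a 2 m 0 u 1 * (A 1 u ^ 2 / 2))"
      by (intro int; use assms in simp)+
    ultimately show ?thesis
      unfolding b2_def m_def by (subst Bochner_Integration.integral_add) (auto simp del: bump.simps)
  qed
  have "\<bar>kernel_integral a m t - ((LINT u|lborel. bump a 0 m 0 (u :: real ^ 'd) 1)
       + t ^ 4 * (LINT u|lborel. fourth_order_term a m u))\<bar>
     \<le> (B * measure lborel (cball (0 :: real ^ 'd) R)) * \<bar>t\<bar> ^ 5" if t: "admissible t" for t
  proof -
    let ?T = "\<lambda>u. bump a 0 m 0 u 1 + b1 u * t + b2 u * t ^ 2 + b3 u * t ^ 3 + fourth_order_term a m u * t ^ 4"
    have iT: "integrable lborel ?T"
      by (intro Bochner_Integration.integrable_add integrable_mult_left i0 i1 i2 i3 i4)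
    have "(LINT u|lborel. ?T u) = (LINT u|lborel. bump a 0 m 0 (u :: real ^ 'd) 1)
       + t ^ 4 * (LINT u|lborel. fourth_order_term a m u)"
      using i0 i1 i2 i3 i4 z1 z2 z3 by (simp add: mult.commute del: bump.simps)
    moreover have "\<bar>kernel_integral a m t - (LINT u|lborel. ?T u)\<bar>
        \<le> (B * \<bar>t\<bar> ^ 5) * measure lborel (cball (0 :: real ^ 'd) R)"
      unfolding kernel_integral_def
    proof (rule integral_approx_on_cball[OF _ iT])
      show "continuous_on (cball 0 R) (\<lambda>u. bump a 0 m 0 u (c (x0 + t *\<^sub>R u)))"
        using assms t by (intro continuous_on_shifted_bump) auto
      show "?T u = 0" if "norm u > R" for u
      proof -
        have "bump a k m 0 u 1 = 0" for k
          using that R_ge_1 by (intro bump_eq_0_norm[of 1]) auto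
        then show ?thesis by (simp add: b1_def b2_def b3_def fourth_order_term_def del: bump.simps)
      qed
      show "\<bar>bump a 0 m 0 u (c (x0 + t *\<^sub>R u)) - ?T u\<bar> \<le> B * \<bar>t\<bar> ^ 5" if "norm u \<le> R" for u
        using B[OF that t] by (simp add: b1_def b2_def b3_def mult.assoc del: bump.simps)
    qed
    ultimately show ?thesis by (simp add: mult_ac)
  qed
  then show ?thesis by blast
qed

end

section \<open>Bias and variance of the adaptive estimator\<close>

text \<open>The indicator makes the kernel Borel measurable on the whole space: the weight is under
  control in the window only.\<close>

definition adaptive_kernel ::
  "(real ^ 'd) set \<Rightarrow> (real ^ 'd \<Rightarrow> real) \<Rightarrow> real \<Rightarrow> real \<Rightarrow> real ^ 'd \<Rightarrow> real ^ 'd \<Rightarrow> real" where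
  "adaptive_kernel W c a h x0 y = indicator W y *
     (c y ^ CARD('d) / h ^ CARD('d) * beta_kernel a (c y *\<^sub>R ((x0 - y) /\<^sub>R h)))"

lemma adaptive_estimator_eq_kernel_sum:
  fixes x0 :: "real ^ 'd"
  shows
  "adaptive_estimator \<Phi> W l a h n x0 \<omega> =
     1 / real n * (\<Sum>i = 1..n. \<Sum>y\<in>\<Phi> i \<omega> \<inter> W. adaptive_kernel W (abramson_weight l x0) a h x0 y)"
proof -
  have "(\<Sum>y\<in>\<Phi> i \<omega> \<inter> W. adaptive_kernel W (abramson_weight l x0) a h x0 y)
    = (\<Sum>y\<in>\<Phi> i \<omega> \<inter> W. abramson_weight l x0 y ^ CARD('d) / h ^ CARD('d) *
       beta_kernel a (abramson_weight l x0 y *\<^sub>R ((x0 - y) /\<^sub>R h)))" for i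
    by (rule sum.cong) (simp_all add: adaptive_kernel_def)
  then show ?thesis by (simp add: adaptive_estimator_def)
qed

context smooth_weight
begin

lemma adaptive_kernel_eq_bump:
  "adaptive_kernel W c a h x0 y =
     indicator W y * bump a 0 CARD('d) 0 ((x0 - y) /\<^sub>R h) (c y) / (h ^ CARD('d) * beta_normaliser TYPE('d) a)"
  unfolding adaptive_kernel_def
  using beta_kernel_eq_bump[of "c y" "CARD('d)" a "(x0 - y) /\<^sub>R h"]
  by (simp add: field_simps del: bump.simps)

lemma adaptive_kernel_measurable: "adaptive_kernel W c a h x0 \<in> borel_measurable borel"
  unfolding adaptive_kernel_eq_bump[abs_def]
  by (intro borel_measurable_divide measurable_weighted_bump) auto

lemma adaptive_kernel_bounds:
  assumes "a > 0" "h > 0"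
  shows "0 \<le> adaptive_kernel W c a h x0 y"
    "adaptive_kernel W c a h x0 y \<le> c_up ^ CARD('d) / (h ^ CARD('d) * beta_normaliser TYPE('d) a)"
proof -
  have N: "beta_normaliser TYPE('d) a > 0" using assms by (intro beta_normaliser_pos)
  have "c_up \<ge> 0" using c_bounds[OF x0_in_W] c_low by auto
  have "0 \<le> bump a 0 CARD('d) 0 ((x0 - y) /\<^sub>R h) (c y)"
    "bump a 0 CARD('d) 0 ((x0 - y) /\<^sub>R h) (c y) \<le> c_up ^ CARD('d)" if "y \<in> W"
  proof -
    have cy: "0 \<le> c y" "c y \<le> c_up" using c_bounds[OF that] c_low by auto
    note le = bump_0_le_power[of a "c y" "CARD('d)" "(x0 - y) /\<^sub>R h"]
    show "0 \<le> bump a 0 CARD('d) 0 ((x0 - y) /\<^sub>R h) (c y)"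
      using assms cy by (intro le) auto
    have "bump a 0 CARD('d) 0 ((x0 - y) /\<^sub>R h) (c y) \<le> c y ^ CARD('d)"
      using assms cy by (intro le) auto
    also have "\<dots> \<le> c_up ^ CARD('d)" using cy by (intro power_mono)
    finally show "bump a 0 CARD('d) 0 ((x0 - y) /\<^sub>R h) (c y) \<le> c_up ^ CARD('d)" .
  qed
  then show "0 \<le> adaptive_kernel W c a h x0 y"
    "adaptive_kernel W c a h x0 y \<le> c_up ^ CARD('d) / (h ^ CARD('d) * beta_normaliser TYPE('d) a)"
    unfolding adaptive_kernel_eq_bump using N assms \<open>c_up \<ge> 0\<close>
    by (cases "y \<in> W"; auto intro!: divide_right_mono divide_nonneg_pos simp del: bump.simps)+
qed

text \<open>Substituting \<open>l = l0 c\<^sup>2\<close> raises the power of the weight from \<open>d\<close> to \<open>d + 2\<close>.\<close>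

lemma integral_kernel_times_intensity:
  assumes h: "h > 0" "admissible h" and "a > 0" and l: "\<And>y. y \<in> W \<Longrightarrow> l y = l0 * (c y)\<^sup>2"
  shows "(LINT y:W|lborel. adaptive_kernel W c a h x0 y * l y) =
     l0 / beta_normaliser TYPE('d) a * kernel_integral a (CARD('d) + 2) (- h)"
proof -
  have "(LINT y:W|lborel. adaptive_kernel W c a h x0 y * l y) =
    (LINT y|lborel. l0 / (h ^ CARD('d) * beta_normaliser TYPE('d) a) *
       (indicator W y * bump a 0 (CARD('d) + 2) 0 ((x0 - y) /\<^sub>R h) (c y)))"
    unfolding set_lebesgue_integral_def adaptive_kernel_eq_bump
    by (intro Bochner_Integration.integral_cong refl)
      (auto simp: l indicator_def power_add power2_eq_square)
  also have "\<dots> = l0 / (h ^ CARD('d) * beta_normaliser TYPE('d) a) * (h ^ CARD('d) * kernel_integral a (CARD('d) + 2) (- h))"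
    using window_integral[OF assms(1-3)] by (simp del: bump.simps)
  finally show ?thesis using h by simp
qed

lemma integral_kernel_square_times_intensity:
  assumes h: "h > 0" "admissible h" and "a > 0" and l: "\<And>y. y \<in> W \<Longrightarrow> l y = l0 * (c y)\<^sup>2"
  shows "(LINT y:W|lborel. (adaptive_kernel W c a h x0 y)\<^sup>2 * l y) =
     l0 / ((beta_normaliser TYPE('d) a)\<^sup>2 * h ^ CARD('d)) * kernel_integral (2 * a) (2 * CARD('d) + 2) (- h)"
proof -
  have "(LINT y:W|lborel. (adaptive_kernel W c a h x0 y)\<^sup>2 * l y) =
    (LINT y|lborel. l0 / (h ^ CARD('d) * beta_normaliser TYPE('d) a)\<^sup>2 *
       (indicator W y * bump (2 * a) 0 (2 * CARD('d) + 2) 0 ((x0 - y) /\<^sub>R h) (c y)))"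
    unfolding set_lebesgue_integral_def adaptive_kernel_eq_bump
  proof (intro Bochner_Integration.integral_cong refl)
    fix y
    show "indicator W y *\<^sub>R ((indicator W y * bump a 0 CARD('d) 0 ((x0 - y) /\<^sub>R h) (c y) / (h ^ CARD('d) * beta_normaliser TYPE('d) a))\<^sup>2 * l y)
      = l0 / (h ^ CARD('d) * beta_normaliser TYPE('d) a)\<^sup>2 *
       (indicator W y * bump (2 * a) 0 (2 * CARD('d) + 2) 0 ((x0 - y) /\<^sub>R h) (c y))"
    proof (cases "y \<in> W")
      case True
      then show ?thesis
        by (simp only: power_divide bump_0_square power_mult_distrib indicator_simps l)
          (simp add: power_add power2_eq_square)
    qed simp
  qed
  also have "\<dots> = l0 / (h ^ CARD('d) * beta_normaliser TYPE('d) a)\<^sup>2 * (h ^ CARD('d) * kernel_integral (2 * a) (2 * CARD('d) + 2) (- h))"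
    using window_integral[OF assms(1,2), of "2 * a"] assms(3) by (simp del: bump.simps)
  finally show ?thesis using h by (simp add: power2_eq_square)
qed

lemma integral_bump_at_1:
  assumes "a > 0"
  shows "(LINT u|lborel. bump a 0 m 0 (u :: real ^ 'd) 1) = beta_normaliser TYPE('d) a"
proof -
  have N: "beta_normaliser TYPE('d) a > 0" using assms by (rule beta_normaliser_pos)
  have "1 = (LINT u|lborel. bump a 0 m 0 (u :: real ^ 'd) 1 / beta_normaliser TYPE('d) a)"
  proof -
    have "beta_kernel a u = bump a 0 m 0 u 1 / beta_normaliser TYPE('d) a" for u :: "real ^ 'd"
      using beta_kernel_eq_bump[of 1 m a u] by (simp del: bump.simps)
    then show ?thesis using integral_beta_kernel[OF assms, where 'd = 'd] by (simp only:)
  qed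
  then show ?thesis using N by (simp del: bump.simps)
qed

lemma integral_bump_at_1_square:
  assumes "a > 0"
  shows "(LINT u|lborel. bump (2 * a) 0 m 0 (u :: real ^ 'd) 1)
     = (beta_normaliser TYPE('d) a)\<^sup>2 * beta_kernel_square_integral TYPE('d) a"
proof -
  have N: "beta_normaliser TYPE('d) a > 0" using assms by (rule beta_normaliser_pos)
  have "(beta_kernel a u)\<^sup>2 = bump (2 * a) 0 m 0 u 1 / (beta_normaliser TYPE('d) a)\<^sup>2" for u :: "real ^ 'd"
    using beta_kernel_eq_bump[of 1 0 a u] bump_0_square[of a 0 u 1]
    by (simp add: power_divide)
  then show ?thesis using N
    by (simp add: beta_kernel_square_integral_def del: bump.simps)
qed

end

lemma (in smooth_weight) expectation_asymptotics:
  assumes "a > 5"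
  shows "\<exists>B. \<forall>h. 0 < h \<longrightarrow> admissible h \<longrightarrow>
     \<bar>l0 / beta_normaliser TYPE('d) a * kernel_integral a (CARD('d) + 2) (- h) -
       (l0 + l0 * h ^ 4 * (LINT u|lborel. fourth_order_term a (CARD('d) + 2) u / beta_normaliser TYPE('d) a))\<bar> \<le> B * h ^ 5"
proof -
  have N: "beta_normaliser TYPE('d) a > 0" using assms by (intro beta_normaliser_pos) auto
  obtain B where B: "\<And>t. admissible t \<Longrightarrow>
    \<bar>kernel_integral a (CARD('d) + 2) t - (beta_normaliser TYPE('d) a + t ^ 4 * (LINT u|lborel. fourth_order_term a (CARD('d) + 2) u))\<bar> \<le> B * \<bar>t\<bar> ^ 5"
    using kernel_integral_order_5[OF assms] integral_bump_at_1[of a] assms by (auto simp del: bump.simps)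
  have "\<bar>l0 / beta_normaliser TYPE('d) a * kernel_integral a (CARD('d) + 2) (- h) -
       (l0 + l0 * h ^ 4 * (LINT u|lborel. fourth_order_term a (CARD('d) + 2) u / beta_normaliser TYPE('d) a))\<bar> \<le> (\<bar>l0 / beta_normaliser TYPE('d) a\<bar> * B) * h ^ 5"
    if h: "0 < h" "admissible h" for h
  proof -
    have "l0 / beta_normaliser TYPE('d) a * kernel_integral a (CARD('d) + 2) (- h) -
       (l0 + l0 * h ^ 4 * (LINT u|lborel. fourth_order_term a (CARD('d) + 2) u / beta_normaliser TYPE('d) a))
      = l0 / beta_normaliser TYPE('d) a * (kernel_integral a (CARD('d) + 2) (- h)
         - (beta_normaliser TYPE('d) a + (- h) ^ 4 * (LINT u|lborel. fourth_order_term a (CARD('d) + 2) u)))"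
      using N by (simp add: field_simps)
    moreover have "\<bar>kernel_integral a (CARD('d) + 2) (- h)
         - (beta_normaliser TYPE('d) a + (- h) ^ 4 * (LINT u|lborel. fourth_order_term a (CARD('d) + 2) u))\<bar> \<le> B * h ^ 5"
      using B[of "- h"] h by (simp add: admissible_def)
    ultimately show ?thesis
      by (simp only: abs_mult mult.assoc) (intro mult_left_mono, auto)
  qed
  then show ?thesis by blast
qed

lemma (in smooth_weight) square_asymptotics:
  assumes "a > 5"
  shows "\<exists>B. \<forall>h. 0 < h \<longrightarrow> admissible h \<longrightarrow>
     \<bar>l0 / (beta_normaliser TYPE('d) a)\<^sup>2 * kernel_integral (2 * a) (2 * CARD('d) + 2) (- h) -
       l0 * beta_kernel_square_integral TYPE('d) a\<bar> \<le> B * h"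
proof -
  have N: "beta_normaliser TYPE('d) a > 0" using assms by (intro beta_normaliser_pos) auto
  obtain B where B: "\<And>t. admissible t \<Longrightarrow>
    \<bar>kernel_integral (2 * a) (2 * CARD('d) + 2) t - (beta_normaliser TYPE('d) a)\<^sup>2 * beta_kernel_square_integral TYPE('d) a\<bar> \<le> B * \<bar>t\<bar>"
    using kernel_integral_order_1[of "2 * a"] integral_bump_at_1_square[of a] assms by (force simp del: bump.simps)
  have "\<bar>l0 / (beta_normaliser TYPE('d) a)\<^sup>2 * kernel_integral (2 * a) (2 * CARD('d) + 2) (- h) -
       l0 * beta_kernel_square_integral TYPE('d) a\<bar> \<le> (\<bar>l0 / (beta_normaliser TYPE('d) a)\<^sup>2\<bar> * B) * h"
    if h: "0 < h" "admissible h" for h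
  proof -
    have "l0 / (beta_normaliser TYPE('d) a)\<^sup>2 * kernel_integral (2 * a) (2 * CARD('d) + 2) (- h) - l0 * beta_kernel_square_integral TYPE('d) a
      = l0 / (beta_normaliser TYPE('d) a)\<^sup>2 * (kernel_integral (2 * a) (2 * CARD('d) + 2) (- h) - (beta_normaliser TYPE('d) a)\<^sup>2 * beta_kernel_square_integral TYPE('d) a)"
      using N by (simp add: field_simps)
    moreover have "\<bar>kernel_integral (2 * a) (2 * CARD('d) + 2) (- h) - (beta_normaliser TYPE('d) a)\<^sup>2 * beta_kernel_square_integral TYPE('d) a\<bar> \<le> B * h"
      using B[of "- h"] h by (simp add: admissible_def)
    ultimately show ?thesis
      by (simp only: abs_mult mult.assoc) (intro mult_left_mono, auto)
  qed
  then show ?thesis by blast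
qed

lemma bias_integrand_eq_fourth_order_term:
  fixes u :: "real ^ 'd"
  assumes "a > 5" "smooth_weight W x0 (abramson_weight l x0) c_low c_up r0"
  shows "bias_integrand l a x0 u = smooth_weight.fourth_order_term x0 (abramson_weight l x0) a (CARD('d) + 2) u
     / beta_normaliser TYPE('d) a"
proof -
  interpret smooth_weight W x0 "abramson_weight l x0" c_low c_up r0 by fact
  have alg: "d1 / b / 24 * a4 + d4 / b / 24 * a1 ^ 4 + d2 / b / 2 * (1 / 3 * a1 * a3 + 1 / 4 * a2\<^sup>2)
      + d3 / b / 4 * a1\<^sup>2 * a2
    = (d1 * a4 / 24 + d2 / 2 * (a1 * a3 / 3 + a2 ^ 2 / 4) + d3 / 4 * a1 ^ 2 * a2 + d4 / 24 * a1 ^ 4) / b"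
    for a1 a2 a3 a4 d1 d2 d3 d4 b :: real
    by (simp add: add_divide_distrib distrib_left)
  have D: "(deriv ^^ k) (g_fun a u) 1 = bump a k (CARD('d) + 2) 0 u 1 / beta_normaliser TYPE('d) a"
    if "real k < 5" for k
    using deriv_g_fun[of k a u] that assms(1) by simp
  have D': "(deriv ^^ 1) (g_fun a u) 1 = bump a 1 (CARD('d) + 2) 0 u 1 / beta_normaliser TYPE('d) a"
    by (rule D) simp
  show ?thesis
    unfolding bias_integrand_def Let_def fourth_order_term_def D'
    by (subst (1 2 3) D; (rule alg | simp))
qed

text \<open>The square root is the power \<open>1/2\<close> of a positive smooth function, and the bounds on the intensity
  carry over.\<close>

lemma smooth_weight_abramson:
  fixes W :: "(real ^ 'd) set"
  assumes "open W" "x0 \<in> W" "0 < lo" and bounds: "l ` W \<subseteq> {lo<..<up}"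
    and l: "times_continuously_differentiable_on 5 l W"
  obtains c_low c_up r0 where "smooth_weight W x0 (abramson_weight l x0) c_low c_up r0"
proof -
  obtain r0 where r0: "r0 > 0" "cball x0 r0 \<subseteq> W"
    using assms(1,2) open_contains_cball by blast
  have pos: "l y > 0" "lo < l y" "l y < up" if "y \<in> W" for y using bounds that \<open>0 < lo\<close> by force+
  have l0: "l x0 > 0" using pos assms by blast
  have "smooth_weight W x0 (abramson_weight l x0) (sqrt (lo / l x0)) (sqrt (up / l x0)) r0"
  proof
    show "abramson_weight l x0 x0 = 1" using l0 by (simp add: abramson_weight_def)
    have "times_continuously_differentiable_on 5 (\<lambda>y. (1 / l x0 * l y) powr (1 / 2)) W"
      using pos l0 by (intro times_continuously_differentiable_on_powr
          times_continuously_differentiable_on_cmult assms(1) l) auto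
    moreover have "abramson_weight l x0 y = (1 / l x0 * l y) powr (1 / 2)" if "y \<in> W" for y
      using pos[OF that] l0 by (simp add: abramson_weight_def powr_half_sqrt)
    ultimately show "times_continuously_differentiable_on 5 (abramson_weight l x0) W"
      by (subst times_continuously_differentiable_on_cong[OF assms(1)]) auto
    show "sqrt (lo / l x0) \<le> abramson_weight l x0 y \<and> abramson_weight l x0 y \<le> sqrt (up / l x0)"
      if "y \<in> W" for y
      using pos[OF that] l0 by (auto simp: abramson_weight_def divide_right_mono)
  qed (use r0 assms l0 in auto)
  then show ?thesis by (rule that)
qed

theorem theorem3:
  fixes M :: "'w measure"
    and \<Phi> :: "nat \<Rightarrow> 'w \<Rightarrow> (real ^ 'd) set"
    and W :: "(real ^ 'd) set"
    and lam :: "real ^ 'd \<Rightarrow> real"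
    and rho2 :: "real ^ 'd \<Rightarrow> real ^ 'd \<Rightarrow> real"
    and lam_low lam_up \<gamma> :: real
    and h :: "nat \<Rightarrow> real"
    and x0 :: "real ^ 'd"
  assumes "prob_space M"
    and "W \<noteq> {}" and "bounded W" and "open W"
    and "iid_point_processes M \<Phi>"
    and "locally_finite_factorial_moments M (\<Phi> 1)"
    and "intensity_function M (\<Phi> 1) W lam"
    and "second_order_product_density M (\<Phi> 1) W rho2"
    and "bounded ((\<lambda>(u, v). pair_correlation lam rho2 u v) ` (W \<times> W))"
    and "0 < lam_low" and "lam_low < lam_up"
    and "lam ` W \<subseteq> {lam_low<..<lam_up}"
    and "times_continuously_differentiable_on 5 lam W"
    and "bounded_partial_derivatives_on 5 lam W"
    and "\<gamma> > 5"
    and "\<And>n. n \<ge> 1 \<Longrightarrow> h n > 0"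
    and "h \<longlonglongrightarrow> 0"
    and "filterlim (\<lambda>n. real n * h n ^ CARD('d)) at_top sequentially"
    and "x0 \<in> W"
  shows "(\<lambda>n. bias M (adaptive_estimator \<Phi> W lam \<gamma> (h n) n x0) (lam x0)
              - lam x0 * h n ^ 4 * (LINT u|lborel. bias_integrand lam \<gamma> x0 u))
           \<in> o[sequentially](\<lambda>n. h n ^ 4)
       \<and> (\<lambda>n. prob_space.variance M (adaptive_estimator \<Phi> W lam \<gamma> (h n) n x0)
              - lam x0 * beta_kernel_square_integral TYPE('d) \<gamma> / (real n * h n ^ CARD('d)))
           \<in> O[sequentially](\<lambda>n. 1 / (real n * h n ^ (CARD('d) - 1)))"
proof -
  let ?c = "abramson_weight lam x0" and ?d = "CARD('d)"
  have pos: "lam y > 0" "lam y < lam_up" if "y \<in> W" for y using assms(10,12) that by force+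
  have lam_c: "lam y = lam x0 * (?c y)\<^sup>2" if "y \<in> W" for y
    using pos[OF that] pos[OF assms(19)] by (simp add: abramson_weight_def)
  obtain c_low c_up r0 where weight: "smooth_weight W x0 ?c c_low c_up r0"
    using smooth_weight_abramson[OF assms(4,19,10,12,13)] .
  interpret smooth_weight W x0 ?c c_low c_up r0 by (fact weight)
  obtain C where C: "\<And>u v. u \<in> W \<Longrightarrow> v \<in> W \<Longrightarrow> \<bar>pair_correlation lam rho2 u v\<bar> \<le> C"
    using assms(9) by (fastforce simp: bounded_iff)
  have C0: "C \<ge> 0" using C[OF assms(19,19)] by linarith
  have obs: "observed_point_process M (\<Phi> 1) W lam rho2 lam_up C"
  proof (intro observed_point_process.intro observed_point_process_axioms.intro)
    show "\<Phi> 1 \<in> measurable M config_space"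
      using assms(5) unfolding iid_point_processes_def point_process_def by blast
    show "lam u \<le> lam_up" if "u \<in> W" for u using pos[OF that] by simp
    fix u v assume uv: "u \<in> W" "v \<in> W"
    have "rho2 u v = pair_correlation lam rho2 u v * (lam u * lam v)"
      using pos(1)[OF uv(1)] pos(1)[OF uv(2)] by (simp add: pair_correlation_def)
    also have "\<dots> \<le> C * (lam u * lam v)"
      using C[OF uv] pos(1)[OF uv(1)] pos(1)[OF uv(2)] by (intro mult_right_mono) auto
    finally show "rho2 u v \<le> C * (lam u * lam v)" .
  qed (use assms C0 in auto)
  let ?K = "\<lambda>n. adaptive_kernel W ?c \<gamma> (h n) x0"
  let ?T = "\<lambda>n. adaptive_estimator \<Phi> W lam \<gamma> (h n) n x0"
  let ?I = "\<lambda>n. lam x0 / beta_normaliser TYPE('d) \<gamma> * kernel_integral \<gamma> (?d + 2) (- h n)"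
  let ?J = "\<lambda>n. lam x0 / (beta_normaliser TYPE('d) \<gamma>)\<^sup>2 * kernel_integral (2 * \<gamma>) (2 * ?d + 2) (- h n)"
  let ?b = "LINT u|lborel. bias_integrand lam \<gamma> x0 u"
  let ?Q = "beta_kernel_square_integral TYPE('d) \<gamma>"
  obtain B1 where B1: "\<And>h. 0 < h \<Longrightarrow> admissible h \<Longrightarrow>
     \<bar>lam x0 / beta_normaliser TYPE('d) \<gamma> * kernel_integral \<gamma> (?d + 2) (- h) - (lam x0 + lam x0 * h ^ 4 * ?b)\<bar> \<le> B1 * h ^ 5"
    using expectation_asymptotics[OF assms(15), of "lam x0"]
      bias_integrand_eq_fourth_order_term[OF assms(15) weight] by auto
  obtain B2 where B2: "\<And>h. 0 < h \<Longrightarrow> admissible h \<Longrightarrow>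
     \<bar>lam x0 / (beta_normaliser TYPE('d) \<gamma>)\<^sup>2 * kernel_integral (2 * \<gamma>) (2 * ?d + 2) (- h) - lam x0 * ?Q\<bar> \<le> B2 * h"
    using square_asymptotics[OF assms(15), of "lam x0"] by auto
  have moments: "prob_space.expectation M (?T n) = ?I n"
    "\<bar>prob_space.variance M (?T n) - ?J n / h n ^ ?d / real n\<bar> \<le> (C + 1) * (?I n)\<^sup>2 / real n"
    if n: "n \<ge> 1" "admissible (h n)" for n
  proof -
    have hn: "h n > 0" using assms(16) n by simp
    have \<gamma>: "\<gamma> > 0" using assms(15) by simp
    note m = sample_mean_moments[OF assms(5) obs adaptive_kernel_measurable
        adaptive_kernel_bounds[OF \<gamma> hn] n(1)]
    note E = integral_kernel_times_intensity[OF hn n(2) \<gamma>, of lam "lam x0", OF lam_c]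
    note V = integral_kernel_square_times_intensity[OF hn n(2) \<gamma>, of lam "lam x0", OF lam_c]
    have T: "?T n = (\<lambda>\<omega>. 1 / real n * (\<Sum>i = 1..n. \<Sum>y\<in>\<Phi> i \<omega> \<inter> W. ?K n y))"
      by (rule ext) (rule adaptive_estimator_eq_kernel_sum)
    have I: "?I n = (LINT y:W|lborel. ?K n y * lam y)"
      by (rule E[symmetric])
    have J: "?J n / h n ^ ?d = (LINT y:W|lborel. (?K n y)\<^sup>2 * lam y)"
      by (rule trans[OF _ V[symmetric]]) simp
    show "prob_space.expectation M (?T n) = ?I n"
      unfolding T I by (rule m(1))
    show "\<bar>prob_space.variance M (?T n) - ?J n / h n ^ ?d / real n\<bar> \<le> (C + 1) * (?I n)\<^sup>2 / real n"
      unfolding J I T by (rule m(2))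
  qed
  have ev: "\<forall>\<^sub>F n in sequentially. n \<ge> 1 \<and> 0 < h n \<and> h n \<le> 1 \<and> admissible (h n)"
  proof -
    have "min 1 (r0 / R) > 0" using r0 R_pos by simp
    then have "\<forall>\<^sub>F n in sequentially. h n < min 1 (r0 / R)"
      using assms(17) by (intro order_tendstoD(2)) auto
    then show ?thesis
      using eventually_ge_at_top[of 1]
    proof eventually_elim
      case (elim n)
      then show ?case using assms(16)[of n] R_pos by (auto simp: admissible_def field_simps)
    qed
  qed
  have "(\<lambda>n. bias M (?T n) (lam x0) - lam x0 * h n ^ 4 * ?b) \<in> O(\<lambda>n. h n ^ 5)"
  proof (rule bigoI)
    show "\<forall>\<^sub>F n in sequentially. norm (bias M (?T n) (lam x0) - lam x0 * h n ^ 4 * ?b) \<le> B1 * norm (h n ^ 5)"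
      using ev
    proof eventually_elim
      case (elim n)
      then show ?case using B1[of "h n"] moments(1)[of n] by (simp add: bias_def algebra_simps)
    qed
  qed
  moreover have "(\<lambda>n. h n ^ 5) \<in> o(\<lambda>n. h n ^ 4)"
  proof (rule smalloI_tendsto)
    have "\<forall>\<^sub>F n in sequentially. h n = h n ^ 5 / h n ^ 4"
      using ev by eventually_elim (simp add: eval_nat_numeral)
    then show "(\<lambda>n. h n ^ 5 / h n ^ 4) \<longlonglongrightarrow> 0"
      using assms(17) by (rule Lim_transform_eventually[rotated])
    show "\<forall>\<^sub>F n in sequentially. h n ^ 4 \<noteq> 0"
      using ev by eventually_elim simp
  qed
  ultimately have bias: "(\<lambda>n. bias M (?T n) (lam x0) - lam x0 * h n ^ 4 * ?b) \<in> o(\<lambda>n. h n ^ 4)"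
    by (rule landau_o.big_small_trans)
  \<comment> \<open>An upper bound for the modulus of the mean for all small \<open>h\<close>.\<close>
  define H where "H = lam x0 + lam x0 * \<bar>?b\<bar> + \<bar>B1\<bar>"
  have "(\<lambda>n. prob_space.variance M (?T n) - lam x0 * ?Q / (real n * h n ^ ?d))
      \<in> O(\<lambda>n. 1 / (real n * h n ^ (?d - 1)))"
  proof (rule bigoI)
    show "\<forall>\<^sub>F n in sequentially. norm (prob_space.variance M (?T n) - lam x0 * ?Q / (real n * h n ^ ?d))
        \<le> ((C + 1) * H\<^sup>2 + B2) * norm (1 / (real n * h n ^ (?d - 1)))"
      using ev
    proof eventually_elim
      case (elim n)
      then have n: "n \<ge> 1" "0 < h n" "h n \<le> 1" "admissible (h n)" by auto
      have p: "h n ^ 4 \<le> 1" "h n ^ 5 \<le> 1" "h n ^ (?d - 1) \<le> 1" "h n ^ (?d - 1) > 0"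
        using n by (auto intro: power_le_one)
      have l0: "lam x0 \<ge> 0" using pos[OF assms(19)] by simp
      have "\<bar>?I n\<bar> \<le> H"
      proof -
        have "\<bar>lam x0 * h n ^ 4 * ?b\<bar> \<le> lam x0 * 1 * \<bar>?b\<bar>"
          using l0 p n unfolding abs_mult by (intro mult_mono) auto
        moreover have "B1 * h n ^ 5 \<le> \<bar>B1\<bar> * 1"
          using p n by (intro mult_mono) auto
        ultimately show ?thesis using B1[OF n(2,4)] l0 unfolding H_def by linarith
      qed
      then have "(?I n)\<^sup>2 \<le> H\<^sup>2"
        by (rule power2_le_iff_abs_le[THEN iffD2, rotated]) (use l0 in \<open>simp add: H_def\<close>)
      then have "(C + 1) * (?I n)\<^sup>2 / real n \<le> (C + 1) * H\<^sup>2 / real n"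
        using C0 by (intro divide_right_mono mult_left_mono) auto
      \<comment> \<open>The dimension is at least one and \<open>h \<le> 1\<close>, so \<open>1 / n\<close> is dominated by the claimed rate.\<close>
      also have "\<dots> \<le> (C + 1) * H\<^sup>2 / (real n * h n ^ (?d - 1))"
        using p n C0 by (intro divide_left_mono mult_nonneg_nonneg mult_pos_pos) (auto intro: mult_left_le)
      finally have a1: "\<bar>prob_space.variance M (?T n) - ?J n / h n ^ ?d / real n\<bar>
          \<le> (C + 1) * H\<^sup>2 / (real n * h n ^ (?d - 1))"
        using moments(2)[OF n(1,4)] by linarith
      \<comment> \<open>Splitting off one factor \<open>h\<close> turns the first order error into the stated rate.\<close>
      have hd: "h n ^ ?d = h n * h n ^ (?d - 1)"
        by (metis Suc_pred' power_Suc zero_less_card_finite)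
      have "\<bar>?J n / h n ^ ?d / real n - lam x0 * ?Q / (real n * h n ^ ?d)\<bar>
          = \<bar>?J n - lam x0 * ?Q\<bar> / (real n * h n ^ ?d)"
      proof -
        have "\<bar>j / b / a - q / (a * b)\<bar> = \<bar>j - q\<bar> / (a * b)" if "a * b > 0" for a b j q :: real
          using that by (simp add: abs_divide abs_of_pos mult.commute flip: diff_divide_distrib)
        then show ?thesis by this (use n in simp)
      qed
      also have "\<dots> \<le> B2 * h n / (real n * h n ^ ?d)"
        using B2[OF n(2,4)] n by (intro divide_right_mono) auto
      also have "\<dots> = B2 / (real n * h n ^ (?d - 1))"
        unfolding hd using n by simp
      finally have a2: "\<bar>?J n / h n ^ ?d / real n - lam x0 * ?Q / (real n * h n ^ ?d)\<bar>
          \<le> B2 / (real n * h n ^ (?d - 1))" .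
      show ?case
        using abs_diff_triangle[OF a1 a2] n by (simp add: add_divide_distrib)
    qed
  qed
  with bias show ?thesis by blast
qed

end
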